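(* Let $(p_n)$ be a sequence of positive integers diverging to $\infty$ as $n\to\infty$. Let the sequence $(\mathrm{P}^{(n)}_{F_n})$ be such that, as $n\to\infty$, (i) $\min\Big(\frac{p_n\tilde e_{n2}^2}{f_{n2}^2},\frac{\tilde e_{n2}}{ne_{n1}^2}\Big)=o(1)$, (ii) $\tilde e_{n4}/\tilde e_{n2}^2=o(n)$, (iii) $f_{n4}/f_{n2}^2=o(n)$, and such that $$ e_{n1}=\frac{\tau}{n^{1/2}p_n^{1/4}}+o\bigg(\frac{1}{n^{1/2}p_n^{1/4}}\bigg)\quad\text{and}\quad\tilde e_{n2}=\frac1{p_n}+o\Big(\frac1{p_n}\Big) $$ for some $\tau\ge0$. Then, for $\alpha\in(0,1)$, under $\mathrm{P}^{(n)}_{F_n}$ the asymptotic power of the high-dimensional Rayleigh test, which rejects when $R_n^{\rm St}>z_\alpha$, is $$ \lim_{n\to\infty}\mathrm{P}^{(n)}_{F_n}\big[R_n^{\rm St}>z_\alpha\big]=1-\Phi\Big(z_\alpha-\frac{\tau^2}{\sqrt2}\Big). $$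
   Context: $\mathcal{S}^{p-1}=\{x\in\mathbb{R}^p:\|x\|=1\}$. A random vector $X$ on $\mathcal{S}^{p-1}$ is rotationally symmetric about $\theta\in\mathcal{S}^{p-1}$ if $OX$ is equal in distribution to $X$ for any orthogonal $p\times p$ matrix $O$ with $O\theta=\theta$. $\mathrm{P}^{(n)}_{F_n}$ denotes the hypothesis under which $X_{n1},\ldots,X_{nn}$ are i.i.d. on $\mathcal{S}^{p_n-1}$ with a common distribution that is rotationally symmetric about $\theta_n$, where $\theta_n$ is the first vector of the canonical basis of $\mathbb{R}^{p_n}$, and such that $X_{ni}'\theta_n$ has cumulative distribution function $F_n$ (no absolute continuity is assumed). Under $\mathrm{P}^{(n)}_{F_n}$, put $e_{n\ell}:=\mathrm{E}[(X_{ni}'\theta_n)^\ell]$, $\tilde e_{n\ell}:=\mathrm{E}[(X_{ni}'\theta_n-e_{n1})^\ell]$, $f_{n\ell}:=\mathrm{E}[(1-(X_{ni}'\theta_n)^2)^{\ell/2}]$. A ratio with positive numerator and zero denominator (e.g. $\tilde e_{n2}/(ne_{n1}^2)$ when $e_{n1}=0$) is read as $+\infty$. The standardized Rayleigh statistic is $R_n^{\rm St}:=\frac{np_n\|\bar X_n\|^2-p_n}{\sqrt{2p_n}}=\frac{\sqrt{2p_n}}{n}\sum_{1\le i<j\le n}X_{ni}'X_{nj}$, with $\bar X_n:=\frac1n\sum_{i=1}^nX_{ni}$. $\Phi$ is the standard normal cumulative distribution function and $z_\alpha:=\Phi^{-1}(1-\alpha)$. *)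

theory Defs
  imports "HOL-Probability.Probability" "HOL-Library.Landau_Symbols"
begin

text \<open>
  The dimension varies along the sequence, so a vector of dimension \<open>p\<close> is an extensional
  function on \<open>{..<p}\<close>, i.e. a point of the product space \<open>R\<^sup>p = PiM {..<p} borel\<close>.  A
  \<open>p \<times> p\<close> matrix is a function \<open>nat \<Rightarrow> nat \<Rightarrow> real\<close> of which only the entries with
  indices below \<open>p\<close> matter.  The Euclidean norm is \<open>L2_set x {..<p}\<close>.
\<close>

abbreviation borel_vec :: "nat \<Rightarrow> (nat \<Rightarrow> real) measure" where
  "borel_vec p \<equiv> PiM {..<p} (\<lambda>_. borel)"

definition vdot :: "nat \<Rightarrow> (nat \<Rightarrow> real) \<Rightarrow> (nat \<Rightarrow> real) \<Rightarrow> real" where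
  "vdot p x y = (\<Sum>k<p. x k * y k)"

definition unit_sphere :: "nat \<Rightarrow> (nat \<Rightarrow> real) set" where
  "unit_sphere p = {x \<in> {..<p} \<rightarrow>\<^sub>E UNIV. L2_set x {..<p} = 1}"

definition first_basis :: "nat \<Rightarrow> nat \<Rightarrow> real" where
  "first_basis p = (\<lambda>k\<in>{..<p}. if k = 0 then 1 else 0)"

definition mat_app :: "nat \<Rightarrow> (nat \<Rightarrow> nat \<Rightarrow> real) \<Rightarrow> (nat \<Rightarrow> real) \<Rightarrow> nat \<Rightarrow> real" where
  "mat_app p A x = (\<lambda>i\<in>{..<p}. \<Sum>j<p. A i j * x j)"

text \<open>The columns of the matrix are orthonormal.\<close>

definition orthogonal_mat :: "nat \<Rightarrow> (nat \<Rightarrow> nat \<Rightarrow> real) \<Rightarrow> bool" where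
  "orthogonal_mat p A \<longleftrightarrow>
     (\<forall>i<p. \<forall>j<p. (\<Sum>k<p. A k i * A k j) = (if i = j then 1 else 0))"

definition rot_symmetric ::
    "'a measure \<Rightarrow> nat \<Rightarrow> (nat \<Rightarrow> real) \<Rightarrow> ('a \<Rightarrow> nat \<Rightarrow> real) \<Rightarrow> bool" where
  "rot_symmetric M p \<theta> Y \<longleftrightarrow>
     (\<forall>A. orthogonal_mat p A \<and> mat_app p A \<theta> = \<theta> \<longrightarrow>
        distr M (borel_vec p) (\<lambda>\<omega>. mat_app p A (Y \<omega>)) = distr M (borel_vec p) Y)"

text \<open>
  The hypothesis \<open>P\<^sub>F\<close> on a sample \<open>X 1, \<dots>, X n\<close> in dimension \<open>p\<close>, defined on the
  probability space \<open>M\<close>.  Measurability of the \<open>X i\<close> is part of \<open>indep_vars\<close>.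
\<close>

definition sample_hyp ::
    "nat \<Rightarrow> nat \<Rightarrow> (real \<Rightarrow> real) \<Rightarrow> 'a measure \<Rightarrow> (nat \<Rightarrow> 'a \<Rightarrow> nat \<Rightarrow> real) \<Rightarrow> bool" where
  "sample_hyp n p F M X \<longleftrightarrow>
     prob_space M \<and>
     prob_space.indep_vars M (\<lambda>_. borel_vec p) X {1..n} \<and>
     (\<exists>Q. \<forall>i\<in>{1..n}. distr M (borel_vec p) (X i) = Q) \<and>
     (\<forall>i\<in>{1..n}.
        (AE \<omega> in M. X i \<omega> \<in> unit_sphere p) \<and>
        rot_symmetric M p (first_basis p) (X i) \<and>
        cdf (distr M borel (\<lambda>\<omega>. vdot p (X i \<omega>) (first_basis p))) = F)"

text \<open>
  The moments \<open>e\<^sub>l\<close>, \<open>\<tilde>e\<^sub>l\<close> and \<open>f\<^sub>l\<close>.  They do not depend on the observation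
  \<open>i\<close>, which is taken to be the first one.  On the sphere \<open>(1 - u\<^sup>2)\<close> raised to \<open>l/2\<close>
  is the \<open>l\<close>-th power of the square root.
\<close>

definition e_mom :: "'a measure \<Rightarrow> nat \<Rightarrow> (nat \<Rightarrow> 'a \<Rightarrow> nat \<Rightarrow> real) \<Rightarrow> nat \<Rightarrow> real" where
  "e_mom M p X l = (\<integral>\<omega>. vdot p (X 1 \<omega>) (first_basis p) ^ l \<partial>M)"

definition e_cmom :: "'a measure \<Rightarrow> nat \<Rightarrow> (nat \<Rightarrow> 'a \<Rightarrow> nat \<Rightarrow> real) \<Rightarrow> nat \<Rightarrow> real" where
  "e_cmom M p X l = (\<integral>\<omega>. (vdot p (X 1 \<omega>) (first_basis p) - e_mom M p X 1) ^ l \<partial>M)"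

definition f_mom :: "'a measure \<Rightarrow> nat \<Rightarrow> (nat \<Rightarrow> 'a \<Rightarrow> nat \<Rightarrow> real) \<Rightarrow> nat \<Rightarrow> real" where
  "f_mom M p X l = (\<integral>\<omega>. sqrt (1 - (vdot p (X 1 \<omega>) (first_basis p))\<^sup>2) ^ l \<partial>M)"

definition sample_mean ::
    "nat \<Rightarrow> nat \<Rightarrow> (nat \<Rightarrow> 'a \<Rightarrow> nat \<Rightarrow> real) \<Rightarrow> 'a \<Rightarrow> nat \<Rightarrow> real" where
  "sample_mean n p X \<omega> = (\<lambda>k\<in>{..<p}. 1 / real n * (\<Sum>i=1..n. X i \<omega> k))"

definition rayleigh_st ::
    "nat \<Rightarrow> nat \<Rightarrow> (nat \<Rightarrow> 'a \<Rightarrow> nat \<Rightarrow> real) \<Rightarrow> 'a \<Rightarrow> real" where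
  "rayleigh_st n p X \<omega> =
     (real n * real p * (L2_set (sample_mean n p X \<omega>) {..<p})\<^sup>2 - real p) / sqrt (2 * real p)"

definition std_normal_cdf :: "real \<Rightarrow> real" where
  "std_normal_cdf = cdf std_normal_distribution"

definition z_quantile :: "real \<Rightarrow> real" where
  "z_quantile \<alpha> = inv std_normal_cdf (1 - \<alpha>)"

end

theory Submission
  imports Defs
begin

text \<open>
  Split each observation into its first coordinate and its tail \<open>Y\<close>.  Since \<open>e1\<close> is of order
  \<open>1 / (sqrt n * root 4 p)\<close> and \<open>e2\<close> of order \<open>1 / p\<close>, the first coordinates contribute
  \<open>\<tau>\<^sup>2 / sqrt 2\<close> plus a term vanishing in mean.  The tails contribute
  \<open>\<kappa> * (\<Sum>j<n. Y (j+1) \<bullet> S j)\<close>, where \<open>S j\<close> is a partial sum and \<open>\<kappa> = sqrt (2p) / n\<close>.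
  By rotational symmetry the law of \<open>Y \<bullet> a\<close> depends on the length of \<open>a\<close> alone, so
  conditionally on the past the characteristic function of an increment is
  \<open>1 - c * (S j \<bullet> S j) / 2\<close> up to a fourth-order term, and \<open>S j \<bullet> S j\<close> concentrates at its
  mean.  The characteristic functions of the partial sums thus nearly satisfy
  \<open>\<phi> (j+1) = exp (- b j) * \<phi> j\<close> with deterministic \<open>b j\<close> whose sum tends to \<open>t\<^sup>2 / 2\<close>, and
  Levy's continuity theorem applies.
\<close>

section \<open>Rotationally symmetric laws on the sphere\<close>

text \<open>The increments are dependent: given the past, the variance of
  \<open>s * (Y (j+1) \<bullet> S j)\<close> is the random number
  \<open>c * (S j \<bullet> S j)\<close>. To unroll a recursion for the characteristic functions the
  factor must be deterministic, so the random variance is replaced by its mean, and over n steps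
  each replacement may cost only o(1/n). Here c is of order 1/n^2, while
  \<open>S j \<bullet> S j\<close> deviates from its mean by at most the order of n * sqrt (1/n +
  1/p) in first absolute moment. The cost per step is therefore of order sqrt (1/n + 1/p) / n, and
  this is where a diverging dimension is decisive: in a fixed dimension the squared length does not
  concentrate. The fourth-order term requires a fourth moment of order 1/p^2 for one tail
  coordinate, whatever the law of the first coordinate. Rotational invariance alone yields it,
  through a comparison with the mixed second moments. Space, law and dimension all change with n, so
  every estimate is an explicit inequality for fixed n and p, and limits are taken only in the last
  proof.\<close>

definition ess_bounded :: "'a measure \<Rightarrow> ('a \<Rightarrow> real) \<Rightarrow> bool" where
  "ess_bounded M f \<longleftrightarrow> f \<in> borel_measurable M \<and> (\<exists>B. AE x in M. \<bar>f x\<bar> \<le> B)"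

text \<open>The real integrands below are built by arithmetic and absolute values from coordinates
  of points of the sphere, so closure of this class under these operations settles their
  integrability. The bound is only almost everywhere because the norm equals 1 only almost
  everywhere.\<close>

lemma ess_bounded_integrable:
  assumes "finite_measure M" "ess_bounded M f"
  shows "integrable M f"
  using assms finite_measure.integrable_const_bound[of M f] by (auto simp: ess_bounded_def)

lemma ess_bounded_const: "ess_bounded M (\<lambda>_. c)"
  by (auto simp: ess_bounded_def)

lemma ess_bounded_add:
  assumes "ess_bounded M f" "ess_bounded M g"
  shows "ess_bounded M (\<lambda>x. f x + g x)"
proof -
  obtain A B where [measurable]: "f \<in> borel_measurable M" "g \<in> borel_measurable M"
    and "AE x in M. \<bar>f x\<bar> \<le> A" "AE x in M. \<bar>g x\<bar> \<le> B"
    using assms by (auto simp: ess_bounded_def)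
  from this(3,4) have "AE x in M. \<bar>f x + g x\<bar> \<le> A + B"
    by eventually_elim linarith
  then show ?thesis by (auto simp: ess_bounded_def)
qed

lemma ess_bounded_mult:
  assumes "ess_bounded M f" "ess_bounded M g"
  shows "ess_bounded M (\<lambda>x. f x * g x)"
proof -
  obtain A B where [measurable]: "f \<in> borel_measurable M" "g \<in> borel_measurable M"
    and "AE x in M. \<bar>f x\<bar> \<le> A" "AE x in M. \<bar>g x\<bar> \<le> B"
    using assms by (auto simp: ess_bounded_def)
  from this(3,4) have "AE x in M. \<bar>f x * g x\<bar> \<le> A * B"
    by eventually_elim (auto simp: abs_mult intro!: mult_mono)
  then show ?thesis by (auto simp: ess_bounded_def)
qed

lemma ess_bounded_diff:
  "ess_bounded M f \<Longrightarrow> ess_bounded M g \<Longrightarrow> ess_bounded M (\<lambda>x. f x - g x)"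
  using ess_bounded_add[of M f "\<lambda>x. - 1 * g x"] ess_bounded_mult[OF ess_bounded_const, of M g "-1"]
  by simp

lemma ess_bounded_power: "ess_bounded M f \<Longrightarrow> ess_bounded M (\<lambda>x. f x ^ m)"
  by (induction m) (simp_all add: ess_bounded_const ess_bounded_mult)

lemma ess_bounded_sum:
  "(\<And>i. i \<in> I \<Longrightarrow> ess_bounded M (f i)) \<Longrightarrow> ess_bounded M (\<lambda>x. \<Sum>i\<in>I. f i x)"
  by (induction I rule: infinite_finite_induct) (simp_all add: ess_bounded_const ess_bounded_add)

lemma ess_bounded_abs: "ess_bounded M f \<Longrightarrow> ess_bounded M (\<lambda>x. \<bar>f x\<bar>)"
  by (auto simp: ess_bounded_def)

lemmas ess_bounded_intros = ess_bounded_const ess_bounded_add ess_bounded_mult ess_bounded_diff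
  ess_bounded_power ess_bounded_sum ess_bounded_abs

section \<open>Inner product of the tails, and reflections that fix the first axis\<close>

definition tail_dot :: "nat \<Rightarrow> (nat \<Rightarrow> real) \<Rightarrow> (nat \<Rightarrow> real) \<Rightarrow> real" where
  "tail_dot p x y = (\<Sum>k\<in>{1..<p}. x k * y k)"

lemma tail_dot_commute: "tail_dot p x y = tail_dot p y x"
  by (simp add: tail_dot_def mult.commute)

lemma tail_dot_add_left: "tail_dot p (\<lambda>k. x k + y k) z = tail_dot p x z + tail_dot p y z"
  by (simp add: tail_dot_def algebra_simps sum.distrib)

lemma tail_dot_diff_left: "tail_dot p (\<lambda>k. x k - y k) z = tail_dot p x z - tail_dot p y z"
  by (simp add: tail_dot_def algebra_simps sum_subtractf)

lemma tail_dot_diff_right: "tail_dot p z (\<lambda>k. x k - y k) = tail_dot p z x - tail_dot p z y"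
  by (simp add: tail_dot_def algebra_simps sum_subtractf)

lemma tail_dot_minus_right: "tail_dot p x (\<lambda>k. - y k) = - tail_dot p x y"
  by (simp add: tail_dot_def sum_negf)

lemma tail_dot_minus_left: "tail_dot p (\<lambda>k. - x k) y = - tail_dot p x y"
  by (simp add: tail_dot_def sum_negf)

lemma tail_dot_add_right: "tail_dot p z (\<lambda>k. x k + y k) = tail_dot p z x + tail_dot p z y"
  by (simp add: tail_dot_def algebra_simps sum.distrib)

lemma tail_dot_self_nonneg: "0 \<le> tail_dot p x x"
  by (simp add: tail_dot_def sum_nonneg)

lemma tail_dot_self_eq_0D: "tail_dot p w w = 0 \<Longrightarrow> k \<in> {1..<p} \<Longrightarrow> w k = 0"
  unfolding tail_dot_def by (subst (asm) sum_nonneg_eq_0_iff) auto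

lemma tail_dot_unit: "k \<in> {1..<p} \<Longrightarrow> tail_dot p x (\<lambda>j. if j = k then c else 0) = c * x k"
  by (simp add: tail_dot_def if_distrib sum.delta cong: if_cong)

lemma tail_dot_cong:
  "(\<And>k. k \<in> {1..<p} \<Longrightarrow> x k = x' k) \<Longrightarrow> (\<And>k. k \<in> {1..<p} \<Longrightarrow> y k = y' k) \<Longrightarrow>
    tail_dot p x y = tail_dot p x' y'"
  by (simp add: tail_dot_def)

lemma measurable_tail_dot [measurable]: "(\<lambda>x. tail_dot p x a) \<in> borel_measurable (borel_vec p)"
  unfolding tail_dot_def by measurable

lemma measurable_tail_dot_self [measurable]: "(\<lambda>x. tail_dot p x x) \<in> borel_measurable (borel_vec p)"
  unfolding tail_dot_def by measurable

text \<open>The reflection in the hyperplane orthogonal to the tail of \<open>w\<close>. Row and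
  column 0 are those of the identity, so \<open>first_basis\<close> stays fixed and rotational
  symmetry applies to this matrix. When the tail of \<open>w\<close> vanishes, division by zero
  makes it the identity.\<close>

definition householder :: "nat \<Rightarrow> (nat \<Rightarrow> real) \<Rightarrow> nat \<Rightarrow> nat \<Rightarrow> real" where
  "householder p w i j = (if i = j then 1 else 0) -
     (if 1 \<le> i \<and> 1 \<le> j then 2 * w i * w j / tail_dot p w w else 0)"

lemma householder_apply:
  assumes "i < p"
  shows "(\<Sum>j<p. householder p w i j * x j) =
    x i - (if 1 \<le> i then 2 * w i * tail_dot p w x / tail_dot p w w else 0)"
proof -
  have "(\<Sum>j<p. householder p w i j * x j) =
      (\<Sum>j<p. if i = j then x j else 0) -
      (\<Sum>j<p. if 1 \<le> i \<and> 1 \<le> j then 2 * w i / tail_dot p w w * (w j * x j) else 0)"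
    unfolding sum_subtractf[symmetric]
    by (intro sum.cong) (auto simp: householder_def field_simps)
  also have "(\<Sum>j<p. if i = j then x j else 0) = x i"
    using assms by simp
  also have "(\<Sum>j<p. if 1 \<le> i \<and> 1 \<le> j then 2 * w i / tail_dot p w w * (w j * x j) else 0) =
      (if 1 \<le> i then \<Sum>j\<in>{j\<in>{..<p}. 1 \<le> j}. 2 * w i / tail_dot p w w * (w j * x j) else 0)"
    unfolding sum.inter_filter[OF finite_lessThan] by (cases "1 \<le> i") simp_all
  also have "{j\<in>{..<p}. 1 \<le> j} = {1..<p}" by auto
  also have "(\<Sum>j\<in>{1..<p}. 2 * w i / tail_dot p w w * (w j * x j)) =
      2 * w i * tail_dot p w x / tail_dot p w w"
    unfolding sum_distrib_left[symmetric] by (simp add: tail_dot_def[of p w x])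
  finally show ?thesis .
qed

lemma householder_sym: "householder p w i j = householder p w j i"
  by (simp add: householder_def mult.commute)

lemma orthogonal_householder:
  assumes "tail_dot p w w \<noteq> 0"
  shows "orthogonal_mat p (householder p w)"
  unfolding orthogonal_mat_def
proof (intro allI impI)
  fix i j assume ij: "i < p" "j < p"
  \<comment> \<open>By symmetry of the matrix this is entry \<open>j\<close> of the reflected
    \<open>w\<close>, with the first coordinate of \<open>w\<close> set to 0; the reflection sends
    \<open>w\<close> to \<open>- w\<close>.\<close>
  have *: "tail_dot p w (\<lambda>k. householder p w k j) = (if 1 \<le> j then - w j else 0)"
  proof -
    have "tail_dot p w (\<lambda>k. householder p w k j) = (\<Sum>k<p. householder p w j k * (if 1 \<le> k then w k else 0))"
    proof -
      have "{k\<in>{..<p}. 1 \<le> k} = {1..<p}" by auto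
      then show ?thesis
        by (simp add: tail_dot_def householder_sym[of _ _ j] mult.commute if_distrib
            sum.inter_filter[symmetric] cong: if_cong)
    qed
    also have "\<dots> = (if 1 \<le> j then w j else 0) -
        (if 1 \<le> j then 2 * w j * tail_dot p w (\<lambda>k. if 1 \<le> k then w k else 0) / tail_dot p w w else 0)"
      using householder_apply[OF ij(2)] by simp
    also have "tail_dot p w (\<lambda>k. if 1 \<le> k then w k else 0) = tail_dot p w w"
      by (rule tail_dot_cong) auto
    finally show ?thesis using assms by auto
  qed
  have "(\<Sum>k<p. householder p w k i * householder p w k j) =
      (\<Sum>k<p. householder p w i k * householder p w k j)"
    by (simp add: householder_sym)
  also have "\<dots> = householder p w i j -
      (if 1 \<le> i then 2 * w i * tail_dot p w (\<lambda>k. householder p w k j) / tail_dot p w w else 0)"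
    by (rule householder_apply[OF ij(1)])
  also have "\<dots> = (if i = j then 1 else 0)"
    using assms unfolding * by (auto simp: householder_def)
  finally show "(\<Sum>k<p. householder p w k i * householder p w k j) = (if i = j then 1 else 0)" .
qed

lemma householder_first_basis: "mat_app p (householder p w) (first_basis p) = first_basis p"
proof
  fix i
  have "tail_dot p w (first_basis p) = 0"
    by (simp add: tail_dot_def first_basis_def)
  then show "mat_app p (householder p w) (first_basis p) i = first_basis p i"
    using householder_apply[of i p w "first_basis p"] by (simp add: mat_app_def first_basis_def)
qed

text \<open>A reflection is self-adjoint, and the one along \<open>a - b\<close> exchanges two
  vectors of equal length. The equality of lengths enters as
  \<open>2 * (w \<bullet> a) = w \<bullet> w\<close>.\<close>

lemma tail_dot_householder:
  assumes eq: "tail_dot p a a = tail_dot p b b"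
    and w: "w = (\<lambda>k. a k - b k)" and ne: "tail_dot p w w \<noteq> 0"
  shows "tail_dot p (mat_app p (householder p w) x) a = tail_dot p x b"
proof -
  have "tail_dot p (mat_app p (householder p w) x) a =
      (\<Sum>k\<in>{1..<p}. x k * a k - 2 * tail_dot p w x / tail_dot p w w * (w k * a k))"
    unfolding tail_dot_def[of p "mat_app p (householder p w) x"]
  proof (rule sum.cong)
    fix k assume k: "k \<in> {1..<p}"
    then have "mat_app p (householder p w) x k = x k - 2 * w k * tail_dot p w x / tail_dot p w w"
      using householder_apply[of k p w x] by (simp add: mat_app_def)
    show "mat_app p (householder p w) x k * a k =
        x k * a k - 2 * tail_dot p w x / tail_dot p w w * (w k * a k)"
      unfolding \<open>mat_app p (householder p w) x k = _\<close> by (simp add: algebra_simps)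
  qed simp
  also have "\<dots> = tail_dot p x a - tail_dot p w x * (2 * tail_dot p w a / tail_dot p w w)"
    unfolding sum_subtractf sum_distrib_left[symmetric]
    by (simp add: tail_dot_def[of p x a] tail_dot_def[of p w a])
  also have "2 * tail_dot p w a = tail_dot p w w"
    using eq unfolding w tail_dot_diff_left tail_dot_diff_right
    by (simp add: tail_dot_commute[of p b a])
  finally show ?thesis
    using ne by (simp add: w tail_dot_diff_left tail_dot_commute[of p _ x])
qed

text \<open>\<open>Q\<close> stands for the law of one observation. At least two coordinates are
  required, so that coordinate 1 can represent the tail and \<open>p - 1\<close> can be divided
  by.\<close>

locale rot_sym_measure = prob_space Q for Q :: "(nat \<Rightarrow> real) measure" +
  fixes p :: nat
  assumes sets_Q [measurable_cong]: "sets Q = sets (borel_vec p)"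
    and p_ge_2: "2 \<le> p"
    and unit_norm: "AE x in Q. (\<Sum>k<p. (x k)\<^sup>2) = 1"
    and invariant: "orthogonal_mat p A \<Longrightarrow> mat_app p A (first_basis p) = first_basis p \<Longrightarrow>
      distr Q (borel_vec p) (mat_app p A) = Q"
begin

lemma measurable_mat_app [measurable]: "mat_app p A \<in> measurable (borel_vec p) (borel_vec p)"
  unfolding mat_app_def by measurable

lemma measurable_coord: "k < p \<Longrightarrow> (\<lambda>x. x k) \<in> borel_measurable Q"
  by measurable

lemma AE_coord_le: "k < p \<Longrightarrow> AE x in Q. \<bar>x k\<bar> \<le> 1"
proof -
  assume k: "k < p"
  show ?thesis
    using unit_norm
  proof eventually_elim
    case (elim x)
    have "(x k)\<^sup>2 \<le> (\<Sum>k<p. (x k)\<^sup>2)"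
      using k by (intro member_le_sum) auto
    then show ?case using elim by (simp add: abs_square_le_1)
  qed
qed

lemma ess_bounded_coord: "k < p \<Longrightarrow> ess_bounded Q (\<lambda>x. x k)"
  using AE_coord_le measurable_coord by (auto simp: ess_bounded_def)

lemma ess_bounded_tail_dot: "ess_bounded Q (\<lambda>x. tail_dot p x a)"
  unfolding tail_dot_def by (intro ess_bounded_intros ess_bounded_coord) auto

lemma ess_bounded_tail_dot_self: "ess_bounded Q (\<lambda>x. tail_dot p x x)"
  unfolding tail_dot_def by (intro ess_bounded_intros ess_bounded_coord) auto

lemma integrable_ess_bounded: "ess_bounded Q f \<Longrightarrow> integrable Q f"
  using ess_bounded_integrable finite_measure_axioms by blast

lemmas integrable_intros = integrable_ess_bounded ess_bounded_intros ess_bounded_tail_dot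
  ess_bounded_tail_dot_self ess_bounded_coord

text \<open>The reflection exchanging \<open>a\<close> and \<open>b\<close> preserves
  \<open>Q\<close>. If the tails of \<open>a\<close> and \<open>b\<close> coincide there is no
  direction to reflect along, whence the case distinction.\<close>

lemma distr_tail_dot_eq:
  assumes "tail_dot p a a = tail_dot p b b"
  shows "distr Q borel (\<lambda>x. tail_dot p x a) = distr Q borel (\<lambda>x. tail_dot p x b)"
proof -
  define w where "w = (\<lambda>k. a k - b k)"
  show ?thesis
  proof (cases "tail_dot p w w = 0")
    case True
    then have "\<And>k. k \<in> {1..<p} \<Longrightarrow> w k = 0"
      by (rule tail_dot_self_eq_0D)
    then have "\<And>x. tail_dot p x a = tail_dot p x b"
      unfolding w_def by (intro tail_dot_cong) auto
    then show ?thesis by simp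
  next
    case False
    have "distr Q borel (\<lambda>x. tail_dot p x a) =
        distr (distr Q (borel_vec p) (mat_app p (householder p w))) borel (\<lambda>x. tail_dot p x a)"
      by (simp add: invariant orthogonal_householder False householder_first_basis)
    also have "\<dots> = distr Q borel (\<lambda>x. tail_dot p (mat_app p (householder p w) x) a)"
      by (subst distr_distr) (auto simp: comp_def)
    also have "\<dots> = distr Q borel (\<lambda>x. tail_dot p x b)"
      by (simp add: tail_dot_householder[OF assms w_def False])
    finally show ?thesis .
  qed
qed

lemma integral_tail_dot_eq:
  fixes g :: "real \<Rightarrow> 'b :: {banach, second_countable_topology}"
  assumes "tail_dot p a a = tail_dot p b b" "g \<in> borel_measurable borel"
  shows "(\<integral>x. g (tail_dot p x a) \<partial>Q) = (\<integral>x. g (tail_dot p x b) \<partial>Q)"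
  using arg_cong[OF distr_tail_dot_eq[OF assms(1)], of "\<lambda>D. integral\<^sup>L D g"] assms(2)
  by (simp add: integral_distr)

text \<open>\<open>a\<close> and \<open>- a\<close> have the same length, so the law of the linear
  form is symmetric about 0.\<close>

lemma integral_tail_dot_odd:
  assumes "g \<in> borel_measurable borel" "\<And>y. g (- y) = - g y"
  shows "(\<integral>x. g (tail_dot p x a) \<partial>Q) = (0::real)"
  using integral_tail_dot_eq[of a "\<lambda>k. - a k" g] assms
  by (simp add: tail_dot_minus_right tail_dot_minus_left)

lemma integral_tail_dot: "(\<integral>x. tail_dot p x a \<partial>Q) = 0"
  using integral_tail_dot_odd[of "\<lambda>y. y"] by simp

lemma integral_tail_dot_power:
  assumes "1 \<le> k" "k < p"
  shows "(\<integral>x. tail_dot p x a ^ m \<partial>Q) = sqrt (tail_dot p a a) ^ m * (\<integral>x. x k ^ m \<partial>Q)"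
proof -
  \<comment> \<open>A multiple of the axis \<open>k\<close> with the same tail length as
    \<open>a\<close>: the linear form becomes a multiple of one coordinate.\<close>
  define b where "b = (\<lambda>j. if j = k then sqrt (tail_dot p a a) else 0)"
  have b: "tail_dot p x b = sqrt (tail_dot p a a) * x k" for x
    unfolding b_def using assms by (subst tail_dot_unit) auto
  have "tail_dot p b b = tail_dot p a a"
    unfolding b by (simp add: b_def tail_dot_self_nonneg)
  then have "(\<integral>x. tail_dot p x a ^ m \<partial>Q) = (\<integral>x. tail_dot p x b ^ m \<partial>Q)"
    by (intro integral_tail_dot_eq) auto
  then show ?thesis by (simp add: b power_mult_distrib)
qed

lemma integral_coord_power:
  assumes "1 \<le> k" "k < p"
  shows "(\<integral>x. x k ^ m \<partial>Q) = (\<integral>x. x 1 ^ m \<partial>Q)"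
  using integral_tail_dot_power[OF assms, of "\<lambda>j. if j = 1 then 1 else 0" m] p_ge_2
  by (simp add: tail_dot_unit)

section \<open>Second and fourth moments of the tail\<close>

definition f2 :: real where "f2 = (\<integral>x. tail_dot p x x \<partial>Q)"

lemma AE_tail_dot_self: "AE x in Q. tail_dot p x x = 1 - (x 0)\<^sup>2"
  using unit_norm
proof eventually_elim
  case (elim x)
  have "(\<Sum>k<p. (x k)\<^sup>2) = (x 0)\<^sup>2 + (\<Sum>k\<in>{1..<p}. (x k)\<^sup>2)"
    using p_ge_2 by (simp add: lessThan_atLeast0 sum.atLeast_Suc_lessThan)
  then show ?case using elim by (simp add: tail_dot_def power2_eq_square)
qed

lemma AE_tail_dot_self_le: "AE x in Q. tail_dot p x x \<le> 1"
  using AE_tail_dot_self by eventually_elim simp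

lemma f2_nonneg: "0 \<le> f2"
  unfolding f2_def by (intro integral_nonneg_AE) (simp add: tail_dot_self_nonneg)

lemma f2_le_1: "f2 \<le> 1"
proof -
  have "f2 \<le> (\<integral>x. 1 \<partial>Q)"
    unfolding f2_def
    by (intro integral_mono_AE AE_tail_dot_self_le) (auto intro: integrable_intros)
  then show ?thesis by (simp add: prob_space)
qed

lemma f2_eq: "f2 = 1 - (\<integral>x. (x 0)\<^sup>2 \<partial>Q)"
proof -
  have "f2 = (\<integral>x. 1 - (x 0)\<^sup>2 \<partial>Q)"
    unfolding f2_def using p_ge_2
    by (intro integral_cong_AE AE_tail_dot_self) (auto intro!: borel_measurable_integrable integrable_intros)
  also have "\<dots> = 1 - (\<integral>x. (x 0)\<^sup>2 \<partial>Q)"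
    using p_ge_2 by (subst Bochner_Integration.integral_diff) (auto simp: prob_space intro!: integrable_intros)
  finally show ?thesis .
qed

text \<open>The \<open>p - 1\<close> tail coordinates have equal second moments, and these add up to
  \<open>f2\<close>.\<close>

lemma integral_coord_square: "(\<integral>x. (x 1)\<^sup>2 \<partial>Q) = f2 / real (p - 1)"
proof -
  have "f2 = (\<Sum>k\<in>{1..<p}. \<integral>x. (x k)\<^sup>2 \<partial>Q)"
    unfolding f2_def tail_dot_def
    by (subst Bochner_Integration.integral_sum) (auto simp: power2_eq_square intro!: integrable_intros)
  also have "\<dots> = (\<Sum>k\<in>{1..<p}. \<integral>x. (x 1)\<^sup>2 \<partial>Q)"
    by (intro sum.cong integral_coord_power) auto
  finally show ?thesis using p_ge_2 by simp
qed

lemma integral_tail_dot_square: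
  "(\<integral>x. (tail_dot p x a)\<^sup>2 \<partial>Q) = f2 / real (p - 1) * tail_dot p a a"
  using integral_tail_dot_power[of 1 a 2] p_ge_2
  by (simp add: integral_coord_square[simplified] tail_dot_self_nonneg)

text \<open>Polarizing \<open>E (X \<cdot> a)\<^sup>4 = |a|\<^sup>4 E X\<^sub>1\<^sup>4\<close> at \<open>a = e\<^sub>k \<plusminus> e\<^sub>l\<close>.\<close>

lemma integral_coord_squares:
  assumes "k \<in> {1..<p}" "l \<in> {1..<p}" "k \<noteq> l"
  shows "(\<integral>x. (x 1)^4 \<partial>Q) = 3 * (\<integral>x. (x k)\<^sup>2 * (x l)\<^sup>2 \<partial>Q)"
proof -
  define m where "m = (\<integral>x. (x 1)^4 \<partial>Q)"
  define a where "a s = (\<lambda>j. (if j = k then 1 else 0) + (if j = l then s else (0::real)))" for s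
  have a: "tail_dot p x (a s) = x k + s * x l" for x s
    unfolding a_def tail_dot_add_right using assms by (simp add: tail_dot_unit)
  have aa: "tail_dot p (a s) (a s) = 1 + s * s" for s
    unfolding a using assms by (simp add: a_def)
  have E: "(\<integral>x. (x k + s * x l)^4 \<partial>Q) = 4 * m" if "s * s = 1" for s
  proof -
    have "(\<integral>x. (x k + s * x l)^4 \<partial>Q) = sqrt 2 ^ 4 * m"
      using integral_tail_dot_power[of 1 "a s" 4] p_ge_2 that unfolding aa unfolding a by (simp add: m_def)
    also have "sqrt 2 ^ 4 = ((sqrt 2)\<^sup>2)\<^sup>2" by (simp del: real_sqrt_pow2)
    also have "\<dots> = 4" by simp
    finally show ?thesis .
  qed
  have lt: "k < p" "l < p" using assms by auto
  \<comment> \<open>Adding the two signs cancels the odd powers and leaves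
    \<open>8 * m = 4 * m + 12 * E\<close>, with \<open>E\<close> the mixed moment.\<close>
  have "8 * m = (\<integral>x. (x k + 1 * x l)^4 \<partial>Q) + (\<integral>x. (x k + (-1) * x l)^4 \<partial>Q)"
    using E[of 1] E[of "-1"] by simp
  also have "\<dots> = (\<integral>x. (x k + 1 * x l)^4 + (x k + (-1) * x l)^4 \<partial>Q)"
    using lt by (intro Bochner_Integration.integral_add[symmetric] integrable_intros) auto
  also have "\<dots> = (\<integral>x. 2 * (x k)^4 + 2 * (x l)^4 + 12 * ((x k)\<^sup>2 * (x l)\<^sup>2) \<partial>Q)"
    by (intro Bochner_Integration.integral_cong refl)
       (simp add: power4_eq_xxxx power2_eq_square algebra_simps)
  also have "\<dots> = 2 * (\<integral>x. (x k)^4 \<partial>Q) + 2 * (\<integral>x. (x l)^4 \<partial>Q) + 12 * (\<integral>x. (x k)\<^sup>2 * (x l)\<^sup>2 \<partial>Q)"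
  proof -
    have i: "integrable Q (\<lambda>x. 2 * (x k)^4)" "integrable Q (\<lambda>x. 2 * (x l)^4)"
      "integrable Q (\<lambda>x. 12 * ((x k)\<^sup>2 * (x l)\<^sup>2))"
      using lt by (intro integrable_intros; simp)+
    show ?thesis
      using Bochner_Integration.integral_add[OF Bochner_Integration.integrable_add[OF i(1,2)] i(3)]
        Bochner_Integration.integral_add[OF i(1,2)] by simp
  qed
  also have "(\<integral>x. (x k)^4 \<partial>Q) = m"
    using assms unfolding m_def by (intro integral_coord_power) auto
  also have "(\<integral>x. (x l)^4 \<partial>Q) = m"
    using assms unfolding m_def by (intro integral_coord_power) auto
  finally show ?thesis unfolding m_def by linarith
qed

text \<open>The mixed moments over all ordered pairs of tail indices add up to the fourth moment of
  the tail length, which is at most 1. Each of these (p - 1)^2 terms is at least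
  \<open>m / 3\<close>: off the diagonal it equals \<open>m / 3\<close>, on the diagonal it equals
  \<open>m\<close>.\<close>

lemma integral_coord_fourth_le: "(\<integral>x. (x 1)^4 \<partial>Q) \<le> 3 / (real (p - 1))\<^sup>2"
proof -
  define m where "m = (\<integral>x. (x 1)^4 \<partial>Q)"
  have m0: "0 \<le> m" unfolding m_def by (intro integral_nonneg_AE) auto
  have ge: "m / 3 \<le> (\<integral>x. (x k)\<^sup>2 * (x l)\<^sup>2 \<partial>Q)" if "k \<in> {1..<p}" "l \<in> {1..<p}" for k l
  proof (cases "k = l")
    case True
    then have "(\<integral>x. (x k)\<^sup>2 * (x l)\<^sup>2 \<partial>Q) = m"
      using integral_coord_power[of k 4] that
      by (simp add: m_def power2_eq_square power4_eq_xxxx mult.assoc)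
    then show ?thesis using m0 by simp
  next
    case False
    then show ?thesis using integral_coord_squares[OF that] by (simp add: m_def)
  qed
  have "(real (p - 1))\<^sup>2 * (m / 3) = (\<Sum>k\<in>{1..<p}. \<Sum>l\<in>{1..<p}. m / 3)"
    using p_ge_2 by (simp add: power2_eq_square of_nat_diff)
  also have "\<dots> \<le> (\<Sum>k\<in>{1..<p}. \<Sum>l\<in>{1..<p}. \<integral>x. (x k)\<^sup>2 * (x l)\<^sup>2 \<partial>Q)"
    by (intro sum_mono ge)
  also have "\<dots> = (\<Sum>k\<in>{1..<p}. \<integral>x. (\<Sum>l\<in>{1..<p}. (x k)\<^sup>2 * (x l)\<^sup>2) \<partial>Q)"
    by (intro sum.cong refl Bochner_Integration.integral_sum[symmetric] integrable_intros) auto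
  also have "\<dots> = (\<integral>x. (\<Sum>k\<in>{1..<p}. \<Sum>l\<in>{1..<p}. (x k)\<^sup>2 * (x l)\<^sup>2) \<partial>Q)"
    by (intro Bochner_Integration.integral_sum[symmetric] integrable_intros) auto
  also have "\<dots> = (\<integral>x. (tail_dot p x x)\<^sup>2 \<partial>Q)"
    by (simp add: tail_dot_def sum_product[symmetric] power2_eq_square)
  also have "\<dots> \<le> (\<integral>x. 1 \<partial>Q)"
  proof (intro integral_mono_AE)
    show "AE x in Q. (tail_dot p x x)\<^sup>2 \<le> 1"
      using AE_tail_dot_self_le
      by eventually_elim (simp add: tail_dot_self_nonneg power_le_one)
  qed (auto intro!: integrable_intros)
  also have "\<dots> = 1" by (simp add: prob_space)
  finally have "m * (real (p - 1))\<^sup>2 \<le> 3" by (simp add: mult.commute)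
  moreover have "0 < (real (p - 1))\<^sup>2" using p_ge_2 by simp
  ultimately show ?thesis unfolding m_def by (simp add: pos_le_divide_eq)
qed

lemma integral_tail_dot_fourth_le:
  "(\<integral>x. (tail_dot p x a)^4 \<partial>Q) \<le> 3 / (real (p - 1))\<^sup>2 * (tail_dot p a a)\<^sup>2"
proof -
  have "sqrt (tail_dot p a a) ^ 4 = ((sqrt (tail_dot p a a))\<^sup>2)\<^sup>2"
    by (simp del: real_sqrt_pow2)
  then have "(\<integral>x. (tail_dot p x a)^4 \<partial>Q) = (tail_dot p a a)\<^sup>2 * (\<integral>x. (x 1)^4 \<partial>Q)"
    using integral_tail_dot_power[of 1 a 4] p_ge_2 by (simp add: tail_dot_self_nonneg)
  then show ?thesis
    using mult_left_mono[OF integral_coord_fourth_le, of "(tail_dot p a a)\<^sup>2"]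
    by (simp add: mult.commute)
qed

text \<open>Third-order Taylor expansion: the linear and cubic terms integrate to zero by symmetry,
  and the quadratic term is known exactly. The remainder contributes 1/24 and the fourth-moment
  bound a factor 3, together 1/8.\<close>

lemma integral_iexp_tail_dot_approx:
  "cmod ((\<integral>x. iexp (t * tail_dot p x a) \<partial>Q) - (1 - t\<^sup>2 * f2 / real (p - 1) * tail_dot p a a / 2))
    \<le> t^4 / 8 * (tail_dot p a a)\<^sup>2 / (real (p - 1))\<^sup>2"
proof -
  define Y where "Y x = t * tail_dot p x a" for x
  have bY: "ess_bounded Q Y" unfolding Y_def by (intro integrable_intros)
  then have [measurable]: "Y \<in> borel_measurable Q" by (simp add: ess_bounded_def)
  have int: "integrable Q (\<lambda>x. Y x ^ k)" for k
    by (intro integrable_intros bY)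
  \<comment> \<open>The Taylor polynomial of degree 3, split into real and imaginary part so that
    only real integrals remain.\<close>
  define g :: "(nat \<Rightarrow> real) \<Rightarrow> complex" where "g x = of_real (1 - (Y x)\<^sup>2 / 2) + \<i> * of_real (Y x - Y x ^ 3 / 6)" for x
  have g: "(\<Sum>k\<le>3. (\<i> * of_real (Y x)) ^ k / fact k) = g x" for x
    by (simp add: g_def eval_nat_numeral field_simps complex_eq_iff)
  have int_g: "integrable Q g"
    unfolding g_def using int[of 1] int by (intro Bochner_Integration.integrable_add
        integrable_mult_right integrable_of_real Bochner_Integration.integrable_diff
        integrable_divide) auto
  have odd1: "(\<integral>x. Y x \<partial>Q) = 0"
    unfolding Y_def by (rule integral_tail_dot_odd) auto
  have odd3: "(\<integral>x. Y x ^ 3 \<partial>Q) = 0"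
    unfolding Y_def by (rule integral_tail_dot_odd) auto
  have "integral\<^sup>L Q g = of_real (\<integral>x. 1 - (Y x)\<^sup>2 / 2 \<partial>Q) + \<i> * of_real (\<integral>x. Y x - Y x ^ 3 / 6 \<partial>Q)"
    unfolding g_def
    using int[of 1] int by (subst Bochner_Integration.integral_add)
       (auto intro!: integrable_mult_right integrable_of_real Bochner_Integration.integrable_diff
        integrable_divide simp del: of_real_diff of_real_divide)
  also have "(\<integral>x. Y x - Y x ^ 3 / 6 \<partial>Q) = 0"
    using int[of 1] int[of 3] by (simp add: odd1 odd3)
  also have "(\<integral>x. 1 - (Y x)\<^sup>2 / 2 \<partial>Q) = 1 - (\<integral>x. (Y x)\<^sup>2 \<partial>Q) / 2"
    using int[of 2] by (simp add: prob_space)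
  also have "(\<integral>x. (Y x)\<^sup>2 \<partial>Q) = t\<^sup>2 * f2 / real (p - 1) * tail_dot p a a"
    unfolding Y_def power_mult_distrib by (simp add: integral_tail_dot_square)
  finally have Eg: "integral\<^sup>L Q g = 1 - t\<^sup>2 * f2 / real (p - 1) * tail_dot p a a / 2" by simp
  have int_e: "integrable Q (\<lambda>x. iexp (Y x))"
    by (intro integrable_iexp) auto
  have "(\<integral>x. iexp (Y x) \<partial>Q) - integral\<^sup>L Q g = (\<integral>x. iexp (Y x) - g x \<partial>Q)"
    using int_e int_g by simp
  also have "cmod \<dots> \<le> (\<integral>x. cmod (iexp (Y x) - g x) \<partial>Q)"
    by (rule integral_norm_bound)
  also have "\<dots> \<le> (\<integral>x. Y x ^ 4 / 24 \<partial>Q)"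
  proof (rule integral_mono)
    show "cmod (iexp (Y x) - g x) \<le> Y x ^ 4 / 24" for x
      using iexp_approx1[of "Y x" 3] unfolding g by (simp add: eval_nat_numeral)
  qed (use int int_e int_g in auto)
  also have "\<dots> = t ^ 4 / 24 * (\<integral>x. (tail_dot p x a) ^ 4 \<partial>Q)"
    unfolding Y_def power_mult_distrib by simp
  also have "\<dots> \<le> t ^ 4 / 24 * (3 / (real (p - 1))\<^sup>2 * (tail_dot p a a)\<^sup>2)"
    by (intro mult_left_mono integral_tail_dot_fourth_le) auto
  finally show ?thesis unfolding Eg Y_def by (simp add: mult.commute)
qed

end

section \<open>Partial sums of the sample\<close>

definition psum :: "(nat \<Rightarrow> nat \<Rightarrow> real) \<Rightarrow> nat \<Rightarrow> nat \<Rightarrow> real" where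
  "psum z j k = (\<Sum>i\<in>{1..j}. z i k)"

text \<open>The unnormalized U-statistic of all pairs among the first \<open>j\<close> tails,
  grouped by the later index, so that each increment pairs a new observation with the sum of the
  earlier ones. Observations are numbered from 1, hence \<open>Suc i\<close>.\<close>

definition pair_sum :: "nat \<Rightarrow> (nat \<Rightarrow> nat \<Rightarrow> real) \<Rightarrow> nat \<Rightarrow> real" where
  "pair_sum p z j = (\<Sum>i<j. tail_dot p (z (Suc i)) (psum z i))"

lemma psum_0: "psum z 0 = (\<lambda>_. 0)"
  by (simp add: psum_def fun_eq_iff)

lemma psum_Suc: "psum z (Suc j) = (\<lambda>k. psum z j k + z (Suc j) k)"
  by (simp add: psum_def fun_eq_iff)

text \<open>This and the next lemma express that the sums up to \<open>j\<close> read only the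
  observations 1 to \<open>j\<close>, the form in which \<open>integral_step\<close> asks for
  dependence on the past.\<close>

lemma psum_restrict: "psum (restrict z {1..j}) j = psum z j"
  by (simp add: psum_def fun_eq_iff)

lemma pair_sum_restrict: "pair_sum p (restrict z {1..j}) j = pair_sum p z j"
  unfolding pair_sum_def
proof (rule sum.cong)
  fix i assume "i \<in> {..<j}"
  then have "psum (restrict z {1..j}) i = psum z i" "restrict z {1..j} (Suc i) = z (Suc i)"
    by (auto simp: psum_def fun_eq_iff)
  then show "tail_dot p (restrict z {1..j} (Suc i)) (psum (restrict z {1..j}) i) =
      tail_dot p (z (Suc i)) (psum z i)" by simp
qed simp

text \<open>The bridge from the Rayleigh statistic, which is a squared length, to a sum whose
  increments have conditional mean zero.\<close>

lemma tail_dot_psum_self: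
  "tail_dot p (psum z j) (psum z j) = (\<Sum>i\<in>{1..j}. tail_dot p (z i) (z i)) + 2 * pair_sum p z j"
proof (induction j)
  case 0
  show ?case by (simp add: psum_0 pair_sum_def tail_dot_def)
next
  case (Suc j)
  have "tail_dot p (psum z (Suc j)) (psum z (Suc j)) = tail_dot p (psum z j) (psum z j) +
      tail_dot p (z (Suc j)) (z (Suc j)) + 2 * tail_dot p (z (Suc j)) (psum z j)"
    by (simp add: psum_Suc tail_dot_add_left tail_dot_add_right tail_dot_commute[of p "psum z j" "z (Suc j)"])
  with Suc show ?case by (simp add: pair_sum_def)
qed

lemma borel_measurable_tail_dot:
  assumes "\<And>k. k < p \<Longrightarrow> (\<lambda>x. f x k) \<in> borel_measurable N"
    and "\<And>k. k < p \<Longrightarrow> (\<lambda>x. g x k) \<in> borel_measurable N"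
  shows "(\<lambda>x. tail_dot p (f x) (g x)) \<in> borel_measurable N"
  unfolding tail_dot_def using assms by (intro borel_measurable_sum borel_measurable_times) auto

lemma ess_bounded_tail_dot_fun:
  assumes "\<And>k. k < p \<Longrightarrow> ess_bounded N (\<lambda>x. f x k)"
    and "\<And>k. k < p \<Longrightarrow> ess_bounded N (\<lambda>x. g x k)"
  shows "ess_bounded N (\<lambda>x. tail_dot p (f x) (g x))"
  unfolding tail_dot_def using assms by (intro ess_bounded_intros) auto

text \<open>Measurability is stated on pairs of a path of length \<open>j\<close> and a next
  observation, the product on which \<open>integral_step\<close> applies Fubini's theorem.\<close>

lemma borel_measurable_path_coord:
  assumes "i \<in> {1..j}" "k < p"
  shows "(\<lambda>z. fst z i k) \<in> borel_measurable (PiM {1..j} (\<lambda>_. borel_vec p) \<Otimes>\<^sub>M borel_vec p)"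
  using measurable_compose[OF measurable_compose[OF measurable_fst
      measurable_component_singleton[OF assms(1)]] measurable_component_singleton[of k "{..<p}"]] assms(2)
  by simp

lemma borel_measurable_next_coord:
  assumes "k < p"
  shows "(\<lambda>z. snd z k) \<in> borel_measurable (PiM {1..j} (\<lambda>_. borel_vec p) \<Otimes>\<^sub>M borel_vec p)"
  using measurable_compose[OF measurable_snd measurable_component_singleton[of k "{..<p}"]] assms
  by simp

lemma borel_measurable_psum:
  assumes "i \<le> j" "k < p"
  shows "(\<lambda>z. psum (fst z) i k) \<in> borel_measurable (PiM {1..j} (\<lambda>_. borel_vec p) \<Otimes>\<^sub>M borel_vec p)"
  unfolding psum_def using assms by (intro borel_measurable_sum borel_measurable_path_coord) auto

lemma borel_measurable_pair_sum:
  "(\<lambda>z. pair_sum p (fst z) j) \<in> borel_measurable (PiM {1..j} (\<lambda>_. borel_vec p) \<Otimes>\<^sub>M borel_vec p)"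
  unfolding pair_sum_def
  by (intro borel_measurable_sum borel_measurable_tail_dot borel_measurable_path_coord
      borel_measurable_psum) auto

lemmas path_measurable_intros = borel_measurable_tail_dot borel_measurable_path_coord
  borel_measurable_next_coord borel_measurable_psum borel_measurable_pair_sum

lemma exp_minus_bound:
  assumes "0 \<le> b"
  shows "\<bar>1 - b - exp (- b)\<bar> \<le> b\<^sup>2 / (2::real)"
proof -
  have "exp (- b) \<ge> 1 - b"
    using exp_ge_add_one_self[of "- b"] by simp
  moreover have "exp (- b) \<le> 1 - b + b\<^sup>2 / 2"
  proof -
    have "\<exists>c. \<bar>c\<bar> \<le> \<bar>- b\<bar> \<and> exp (- b) = (\<Sum>m<3. (- b) ^ m / fact m) + exp c / fact 3 * (- b) ^ 3"
      by (rule Maclaurin_exp_le)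
    then obtain c where "exp (- b) = (\<Sum>m<3. (- b) ^ m / fact m) + exp c / fact 3 * (- b) ^ 3"
      by blast
    moreover have "(\<Sum>m<3. (- b) ^ m / fact m) = 1 - b + b\<^sup>2 / 2"
      by (simp add: eval_nat_numeral)
    \<comment> \<open>The Lagrange remainder of odd order has the sign of
      \<open>- b\<close>.\<close>
    moreover have "exp c / fact 3 * (- b) ^ 3 \<le> 0"
      using assms by (auto simp: eval_nat_numeral mult_nonneg_nonpos2 intro!: mult_nonneg_nonpos)
    ultimately show ?thesis by linarith
  qed
  ultimately show ?thesis by simp
qed

locale rot_sample = prob_space M + Q: rot_sym_measure Q p
  for M :: "'a measure" and Q p +
  fixes n :: nat and X :: "nat \<Rightarrow> 'a \<Rightarrow> nat \<Rightarrow> real"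
  assumes n_pos: "1 \<le> n"
    and indep: "indep_vars (\<lambda>_. borel_vec p) X {1..n}"
    and distr_X: "i \<in> {1..n} \<Longrightarrow> distr M (borel_vec p) (X i) = Q"
begin

section \<open>Independence and conditioning on the past\<close>

definition obs :: "'a \<Rightarrow> nat \<Rightarrow> nat \<Rightarrow> real" where
  "obs \<omega> = (\<lambda>i. X i \<omega>)"

lemma measurable_X: "i \<in> {1..n} \<Longrightarrow> X i \<in> measurable M (borel_vec p)"
  using indep unfolding indep_vars_def by auto

lemma AE_X: "i \<in> {1..n} \<Longrightarrow> AE x in Q. P x \<Longrightarrow> AE \<omega> in M. P (X i \<omega>)"
  by (rule AE_distrD[OF measurable_X]) (simp_all only: distr_X)

lemma integral_X:
  fixes g :: "(nat \<Rightarrow> real) \<Rightarrow> 'b :: {banach, second_countable_topology}"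
  assumes "i \<in> {1..n}" "g \<in> borel_measurable (borel_vec p)"
  shows "(\<integral>\<omega>. g (X i \<omega>) \<partial>M) = (\<integral>x. g x \<partial>Q)"
  using integral_distr[OF measurable_X[OF assms(1)] assms(2)] unfolding distr_X[OF assms(1)] ..

lemma ess_bounded_X:
  assumes "i \<in> {1..n}" "k < p"
  shows "ess_bounded M (\<lambda>\<omega>. X i \<omega> k)"
proof -
  have "(\<lambda>\<omega>. X i \<omega> k) \<in> borel_measurable M"
    using measurable_compose[OF measurable_X[OF assms(1)] measurable_component_singleton] assms(2)
    by auto
  moreover have "AE \<omega> in M. \<bar>X i \<omega> k\<bar> \<le> 1"
    using assms by (intro AE_X Q.AE_coord_le)
  ultimately show ?thesis by (auto simp: ess_bounded_def)
qed

lemma ess_bounded_obs: "i \<in> {1..n} \<Longrightarrow> k < p \<Longrightarrow> ess_bounded M (\<lambda>\<omega>. obs \<omega> i k)"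
  unfolding obs_def by (rule ess_bounded_X)

lemma ess_bounded_psum: "j \<le> n \<Longrightarrow> k < p \<Longrightarrow> ess_bounded M (\<lambda>\<omega>. psum (obs \<omega>) j k)"
  unfolding psum_def by (intro ess_bounded_intros ess_bounded_obs) auto

lemma ess_bounded_pair_sum: "j \<le> n \<Longrightarrow> ess_bounded M (\<lambda>\<omega>. pair_sum p (obs \<omega>) j)"
  unfolding pair_sum_def
  by (intro ess_bounded_intros ess_bounded_tail_dot_fun ess_bounded_obs ess_bounded_psum) auto

lemma integrable_ess_bounded: "ess_bounded M f \<Longrightarrow> integrable M f"
  using ess_bounded_integrable finite_measure_axioms by blast

lemmas integrable_intros = integrable_ess_bounded ess_bounded_intros ess_bounded_tail_dot_fun
  ess_bounded_obs ess_bounded_psum ess_bounded_pair_sum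

text \<open>The first \<open>j\<close> observations are independent of the next one, so their joint
  law is a product and the next one can be integrated out with the past held fixed. The assumption
  \<open>past\<close> is there because \<open>obs \<omega>\<close> carries all indices and need not
  lie in the product space over \<open>{1..j}\<close>.\<close>

lemma integral_step:
  fixes f :: "(nat \<Rightarrow> nat \<Rightarrow> real) \<times> (nat \<Rightarrow> real) \<Rightarrow> 'b :: {banach, second_countable_topology}"
  assumes j: "j < n"
    and f [measurable]: "f \<in> borel_measurable (PiM {1..j} (\<lambda>_. borel_vec p) \<Otimes>\<^sub>M borel_vec p)"
    and past: "\<And>z x. f (restrict z {1..j}, x) = f (z, x)"
    and int: "integrable M (\<lambda>\<omega>. f (obs \<omega>, obs \<omega> (Suc j)))"
  shows "integrable M (\<lambda>\<omega>. \<integral>x. f (obs \<omega>, x) \<partial>Q)"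
    and "(\<integral>\<omega>. f (obs \<omega>, obs \<omega> (Suc j)) \<partial>M) = (\<integral>\<omega>. (\<integral>x. f (obs \<omega>, x) \<partial>Q) \<partial>M)"
proof -
  let ?P = "PiM {1..j} (\<lambda>_. borel_vec p)" and ?R = "PiM {Suc j} (\<lambda>_. borel_vec p)"
  let ?U = "\<lambda>\<omega>. restrict (\<lambda>i. X i \<omega>) {1..j}" and ?V = "\<lambda>\<omega>. restrict (\<lambda>i. X i \<omega>) {Suc j}"
  have "indep_var ?P ?U ?R ?V"
    using j by (intro indep_var_restrict[OF indep]) auto
  then have U [measurable]: "?U \<in> measurable M ?P" and V [measurable]: "?V \<in> measurable M ?R"
    and D: "distr M ?P ?U \<Otimes>\<^sub>M distr M ?R ?V = distr M (?P \<Otimes>\<^sub>M ?R) (\<lambda>\<omega>. (?U \<omega>, ?V \<omega>))"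
    unfolding indep_var_distribution_eq by auto
  \<comment> \<open>Independence delivers the next observation as a family over the singleton
    \<open>{Suc j}\<close>; \<open>g\<close> reads off its only member.\<close>
  define g where "g = (\<lambda>z. f (fst z, snd z (Suc j)))"
  have [measurable]: "(\<lambda>y. y (Suc j)) \<in> measurable ?R (borel_vec p)"
    by (rule measurable_component_singleton) simp
  have g [measurable]: "g \<in> borel_measurable (?P \<Otimes>\<^sub>M ?R)"
    unfolding g_def by measurable
  interpret U: prob_space "distr M ?P ?U" by (rule prob_space_distr) (rule U)
  interpret V: prob_space "distr M ?R ?V" by (rule prob_space_distr) (rule V)
  interpret pair_sigma_finite "distr M ?P ?U" "distr M ?R ?V" ..
  have gf: "g (?U \<omega>, ?V \<omega>) = f (obs \<omega>, obs \<omega> (Suc j))" for \<omega>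
    by (simp add: g_def past obs_def del: One_nat_def)
  have inner: "(\<integral>y. g (z, y) \<partial>distr M ?R ?V) = (\<integral>x. f (z, x) \<partial>Q)" if "z \<in> space ?P" for z
  proof -
    have fz [measurable]: "(\<lambda>x. f (z, x)) \<in> borel_measurable (borel_vec p)"
      using that by measurable
    have "(\<integral>y. g (z, y) \<partial>distr M ?R ?V) = (\<integral>\<omega>. g (z, ?V \<omega>) \<partial>M)"
      using that by (intro integral_distr) measurable
    also have "\<dots> = (\<integral>\<omega>. f (z, X (Suc j) \<omega>) \<partial>M)"
      by (simp add: g_def)
    also have "\<dots> = (\<integral>x. f (z, x) \<partial>Q)"
      using j by (intro integral_X fz) auto
    finally show ?thesis .
  qed
  have inner': "(\<integral>y. g (?U \<omega>, y) \<partial>distr M ?R ?V) = (\<integral>x. f (obs \<omega>, x) \<partial>Q)"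
    if "\<omega> \<in> space M" for \<omega>
    using inner[OF measurable_space[OF U that]] by (simp add: past obs_def del: One_nat_def)
  have int': "integrable (distr M ?P ?U \<Otimes>\<^sub>M distr M ?R ?V) g"
    unfolding D using int by (subst integrable_distr_eq) (simp_all add: gf del: One_nat_def)
  have meas: "(\<lambda>z. \<integral>y. g (z, y) \<partial>distr M ?R ?V) \<in> borel_measurable ?P"
    using g by (intro V.borel_measurable_lebesgue_integral)
      (simp cong: measurable_cong_sets sets_pair_measure_cong)
  show "integrable M (\<lambda>\<omega>. \<integral>x. f (obs \<omega>, x) \<partial>Q)"
    using integrable_fst'[OF int'] unfolding integrable_distr_eq[OF U meas]
    by (simp cong: Bochner_Integration.integrable_cong add: inner' del: One_nat_def)
  have "(\<integral>\<omega>. f (obs \<omega>, obs \<omega> (Suc j)) \<partial>M) = (\<integral>\<omega>. g (?U \<omega>, ?V \<omega>) \<partial>M)"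
    unfolding gf ..
  also have "\<dots> = integral\<^sup>L (distr M ?P ?U \<Otimes>\<^sub>M distr M ?R ?V) g"
    unfolding D by (rule integral_distr[symmetric]) measurable
  also have "\<dots> = (\<integral>z. (\<integral>y. g (z, y) \<partial>distr M ?R ?V) \<partial>distr M ?P ?U)"
    using integral_fst'[OF int'] by simp
  also have "\<dots> = (\<integral>\<omega>. (\<integral>y. g (?U \<omega>, y) \<partial>distr M ?R ?V) \<partial>M)"
    by (rule integral_distr[OF U meas])
  also have "\<dots> = (\<integral>\<omega>. (\<integral>x. f (obs \<omega>, x) \<partial>Q) \<partial>M)"
    by (intro Bochner_Integration.integral_cong refl inner')
  finally show "(\<integral>\<omega>. f (obs \<omega>, obs \<omega> (Suc j)) \<partial>M) = (\<integral>\<omega>. (\<integral>x. f (obs \<omega>, x) \<partial>Q) \<partial>M)" .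
qed

section \<open>Concentration of the squared length of the tail sums\<close>

definition sq :: "nat \<Rightarrow> 'a \<Rightarrow> real" where
  "sq j \<omega> = tail_dot p (psum (obs \<omega>) j) (psum (obs \<omega>) j)"

lemma ess_bounded_sq: "j \<le> n \<Longrightarrow> ess_bounded M (sq j)"
  unfolding sq_def[abs_def] by (intro integrable_intros) auto

lemma sq_Suc: "sq (Suc j) \<omega> = sq j \<omega> + tail_dot p (obs \<omega> (Suc j)) (obs \<omega> (Suc j)) +
    2 * tail_dot p (obs \<omega> (Suc j)) (psum (obs \<omega>) j)"
  by (simp add: sq_def psum_Suc tail_dot_add_left tail_dot_add_right
      tail_dot_commute[of p "psum (obs \<omega>) j" "obs \<omega> (Suc j)"])

lemma integral_sq: "j \<le> n \<Longrightarrow> (\<integral>\<omega>. sq j \<omega> \<partial>M) = real j * Q.f2"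
proof (induction j)
  case 0
  show ?case by (simp add: sq_def psum_0 tail_dot_def)
next
  case (Suc j)
  then have j: "j < n" by simp
  define f where "f = (\<lambda>(z, x). tail_dot p (psum z j) (psum z j) + tail_dot p x x +
    2 * tail_dot p x (psum z j))"
  have f: "f = (\<lambda>z. tail_dot p (psum (fst z) j) (psum (fst z) j) + tail_dot p (snd z) (snd z) +
    2 * tail_dot p (snd z) (psum (fst z) j))"
    by (auto simp: f_def)
  have "(\<integral>\<omega>. sq (Suc j) \<omega> \<partial>M) = (\<integral>\<omega>. f (obs \<omega>, obs \<omega> (Suc j)) \<partial>M)"
    unfolding sq_Suc by (simp add: f_def sq_def)
  also have "\<dots> = (\<integral>\<omega>. (\<integral>x. f (obs \<omega>, x) \<partial>Q) \<partial>M)"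
  proof (rule integral_step(2)[OF j])
    show "f \<in> borel_measurable (PiM {1..j} (\<lambda>_. borel_vec p) \<Otimes>\<^sub>M borel_vec p)"
      unfolding f by (intro borel_measurable_add borel_measurable_times borel_measurable_const
          path_measurable_intros) auto
    show "f (restrict z {1..j}, x) = f (z, x)" for z x
      by (simp add: f_def psum_restrict del: One_nat_def)
    show "integrable M (\<lambda>\<omega>. f (obs \<omega>, obs \<omega> (Suc j)))"
      using j unfolding f_def by (simp, intro integrable_intros) auto
  qed
  also have "(\<lambda>\<omega>. \<integral>x. f (obs \<omega>, x) \<partial>Q) = (\<lambda>\<omega>. sq j \<omega> + Q.f2)"
  proof
    fix \<omega>
    have "integrable Q (\<lambda>x. tail_dot p x x)" "integrable Q (\<lambda>x. tail_dot p x (psum (obs \<omega>) j))"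
      by (intro Q.integrable_intros)+
    then show "(\<integral>x. f (obs \<omega>, x) \<partial>Q) = sq j \<omega> + Q.f2"
      by (simp add: f_def sq_def Q.prob_space Q.integral_tail_dot Q.f2_def)
  qed
  also have "(\<integral>\<omega>. sq j \<omega> + Q.f2 \<partial>M) = (\<integral>\<omega>. sq j \<omega> \<partial>M) + Q.f2"
    using j integrable_ess_bounded[OF ess_bounded_sq, of j] by (simp add: prob_space)
  finally show ?case using Suc by (simp add: algebra_simps)
qed

text \<open>From \<open>(u + 2 * v)\<^sup>2 \<le> 2 * u\<^sup>2 + 8 * v\<^sup>2\<close>, where
  \<open>u\<close> is the centered squared length of the new tail, at most 1 in absolute value, and
  \<open>v\<close> its inner product with \<open>a\<close>. Integrating the square of
  \<open>v\<close> brings in the factor 1/(p - 1).\<close>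

lemma integral_increment_square_le:
  "(\<integral>x. (tail_dot p x x - Q.f2 + 2 * tail_dot p x a)\<^sup>2 \<partial>Q) \<le> 2 + 8 / real (p - 1) * tail_dot p a a"
proof -
  have "(\<integral>x. (tail_dot p x x - Q.f2 + 2 * tail_dot p x a)\<^sup>2 \<partial>Q) \<le>
      (\<integral>x. 2 + 8 * (tail_dot p x a)\<^sup>2 \<partial>Q)"
  proof (intro integral_mono_AE)
    show "AE x in Q. (tail_dot p x x - Q.f2 + 2 * tail_dot p x a)\<^sup>2 \<le> 2 + 8 * (tail_dot p x a)\<^sup>2"
      using Q.AE_tail_dot_self_le
    proof eventually_elim
      case (elim x)
      let ?u = "tail_dot p x x - Q.f2" and ?v = "tail_dot p x a"
      have "\<bar>?u\<bar> \<le> 1"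
        using elim Q.f2_nonneg Q.f2_le_1 tail_dot_self_nonneg[of p x] by linarith
      then have "?u\<^sup>2 \<le> 1" by (simp add: abs_square_le_1)
      moreover have "(?u + 2 * ?v)\<^sup>2 \<le> 2 * ?u\<^sup>2 + 8 * ?v\<^sup>2"
        using zero_le_power2[of "?u - 2 * ?v"] by (simp add: power2_eq_square algebra_simps)
      ultimately show ?case by linarith
    qed
  qed (intro Q.integrable_intros)+
  also have "\<dots> = 2 + 8 * (Q.f2 / real (p - 1) * tail_dot p a a)"
    using Q.integrable_ess_bounded[OF ess_bounded_power[OF Q.ess_bounded_tail_dot]]
    by (simp add: Q.prob_space Q.integral_tail_dot_square)
  also have "\<dots> \<le> 2 + 8 * (1 / real (p - 1) * tail_dot p a a)"
    using Q.f2_le_1 by (intro add_left_mono mult_left_mono mult_right_mono divide_right_mono)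
      (auto simp: tail_dot_self_nonneg)
  finally show ?thesis by simp
qed

definition dev :: "nat \<Rightarrow> 'a \<Rightarrow> real" where
  "dev j \<omega> = sq j \<omega> - real j * Q.f2"

lemma ess_bounded_dev: "j \<le> n \<Longrightarrow> ess_bounded M (dev j)"
  unfolding dev_def[abs_def] by (intro ess_bounded_diff ess_bounded_const ess_bounded_sq)

text \<open>\<open>dev\<close> is a martingale: its increment \<open>h\<close> has conditional mean
  zero, so the cross term vanishes and the second moments of the increments add up.\<close>

lemma integral_dev_square_Suc:
  assumes j: "j < n"
  shows "(\<integral>\<omega>. (dev (Suc j) \<omega>)\<^sup>2 \<partial>M) \<le> (\<integral>\<omega>. (dev j \<omega>)\<^sup>2 \<partial>M) + 2 + 8 * real j / real (p - 1)"
proof -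
  define d where "d z = tail_dot p (psum z j) (psum z j) - real j * Q.f2" for z
  define h where "h z x = tail_dot p x x - Q.f2 + 2 * tail_dot p x (psum z j)" for z x
  define f where "f = (\<lambda>(z, x). (d z + h z x)\<^sup>2)"
  have f: "f = (\<lambda>z. (d (fst z) + h (fst z) (snd z))\<^sup>2)"
    by (auto simp: f_def)
  have past: "f (restrict z {1..j}, x) = f (z, x)" for z x
    by (simp add: f_def d_def h_def psum_restrict del: One_nat_def)
  have meas: "f \<in> borel_measurable (PiM {1..j} (\<lambda>_. borel_vec p) \<Otimes>\<^sub>M borel_vec p)"
    unfolding f d_def h_def by (intro borel_measurable_power borel_measurable_add
        borel_measurable_diff borel_measurable_times borel_measurable_const path_measurable_intros) auto
  have int: "integrable M (\<lambda>\<omega>. f (obs \<omega>, obs \<omega> (Suc j)))"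
    using j unfolding f_def d_def h_def by (simp, intro integrable_intros) auto
  have int_dev: "integrable M (\<lambda>\<omega>. (dev j \<omega>)\<^sup>2)" and int_sq: "integrable M (sq j)"
    using j by (intro integrable_ess_bounded ess_bounded_intros ess_bounded_dev ess_bounded_sq; simp)+
  have inner: "(\<integral>x. f (obs \<omega>, x) \<partial>Q) \<le> (dev j \<omega>)\<^sup>2 + (2 + 8 / real (p - 1) * sq j \<omega>)" for \<omega>
  proof -
    let ?h = "h (obs \<omega>)"
    have bh: "ess_bounded Q ?h"
      unfolding h_def by (intro Q.integrable_intros)
    have "(\<integral>x. ?h x \<partial>Q) = 0"
      using Q.integrable_ess_bounded[OF Q.ess_bounded_tail_dot]
        Q.integrable_ess_bounded[OF Q.ess_bounded_tail_dot_self]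
      by (simp add: h_def Q.prob_space Q.integral_tail_dot Q.f2_def)
    moreover have "f (obs \<omega>, x) = (dev j \<omega>)\<^sup>2 + 2 * dev j \<omega> * ?h x + (?h x)\<^sup>2" for x
      by (simp add: f_def dev_def sq_def d_def power2_eq_square algebra_simps)
    ultimately have "(\<integral>x. f (obs \<omega>, x) \<partial>Q) = (dev j \<omega>)\<^sup>2 + (\<integral>x. (?h x)\<^sup>2 \<partial>Q)"
      using Q.integrable_ess_bounded[OF bh] Q.integrable_ess_bounded[OF ess_bounded_power[OF bh]]
      by (simp add: Q.prob_space)
    then show ?thesis
      using integral_increment_square_le[of "psum (obs \<omega>) j"] by (simp add: h_def sq_def)
  qed
  have "dev (Suc j) \<omega> = d (obs \<omega>) + h (obs \<omega>) (obs \<omega> (Suc j))" for \<omega>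
    unfolding dev_def sq_Suc d_def h_def by (simp add: sq_def algebra_simps)
  then have "(\<integral>\<omega>. (dev (Suc j) \<omega>)\<^sup>2 \<partial>M) = (\<integral>\<omega>. f (obs \<omega>, obs \<omega> (Suc j)) \<partial>M)"
    by (simp add: f_def)
  also have "\<dots> = (\<integral>\<omega>. (\<integral>x. f (obs \<omega>, x) \<partial>Q) \<partial>M)"
    by (rule integral_step(2)[OF j meas past int])
  also have "\<dots> \<le> (\<integral>\<omega>. (dev j \<omega>)\<^sup>2 + (2 + 8 / real (p - 1) * sq j \<omega>) \<partial>M)"
    using int_dev int_sq
    by (intro integral_mono integral_step(1)[OF j meas past int] inner) auto
  also have "\<dots> = (\<integral>\<omega>. (dev j \<omega>)\<^sup>2 \<partial>M) + (2 + 8 / real (p - 1) * (real j * Q.f2))"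
    using int_dev int_sq j by (simp add: prob_space integral_sq)
  also have "8 / real (p - 1) * (real j * Q.f2) \<le> 8 / real (p - 1) * (real j * 1)"
    using Q.f2_le_1 by (intro mult_left_mono) auto
  finally show ?thesis by simp
qed

lemma integral_dev_square_le:
  "j \<le> n \<Longrightarrow> (\<integral>\<omega>. (dev j \<omega>)\<^sup>2 \<partial>M) \<le> 2 * real j + 8 * (real j)\<^sup>2 / real (p - 1)"
proof (induction j)
  case 0
  show ?case by (simp add: dev_def sq_def psum_0 tail_dot_def)
next
  case (Suc j)
  \<comment> \<open>The accumulated terms \<open>8 * i / (p - 1)\<close> are bounded crudely, using
    only \<open>j\<^sup>2 + j \<le> (j + 1)\<^sup>2\<close>.\<close>
  have "8 * (real j)\<^sup>2 / real (p - 1) + 8 * real j / real (p - 1) =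
      8 * ((real j)\<^sup>2 + real j) / real (p - 1)"
    by (simp add: add_divide_distrib)
  also have "\<dots> \<le> 8 * (real (Suc j))\<^sup>2 / real (p - 1)"
    by (intro divide_right_mono mult_left_mono) (auto simp: power2_eq_square algebra_simps)
  finally show ?case
    using Suc integral_dev_square_Suc[of j] by simp
qed

text \<open>The variance of \<open>\<bar>dev j\<bar>\<close> is nonnegative. For \<open>j\<close> up
  to \<open>n\<close> the bound is at most the order of n * sqrt (1/n + 1/p).\<close>

lemma integral_abs_dev_le:
  assumes "j \<le> n"
  shows "(\<integral>\<omega>. \<bar>dev j \<omega>\<bar> \<partial>M) \<le> sqrt (2 * real j + 8 * (real j)\<^sup>2 / real (p - 1))"
proof (rule real_le_rsqrt)
  have "integrable M (\<lambda>\<omega>. \<bar>dev j \<omega>\<bar>)" "integrable M (\<lambda>\<omega>. (\<bar>dev j \<omega>\<bar>)\<^sup>2)"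
    by (intro integrable_ess_bounded ess_bounded_intros ess_bounded_dev assms)+
  then have "(\<integral>\<omega>. \<bar>dev j \<omega>\<bar> \<partial>M)\<^sup>2 \<le> (\<integral>\<omega>. \<bar>dev j \<omega>\<bar>\<^sup>2 \<partial>M)"
    using variance_eq[of "\<lambda>\<omega>. \<bar>dev j \<omega>\<bar>"] variance_positive[of "\<lambda>\<omega>. \<bar>dev j \<omega>\<bar>"] by simp
  then show "(\<integral>\<omega>. \<bar>dev j \<omega>\<bar> \<partial>M)\<^sup>2 \<le> 2 * real j + 8 * (real j)\<^sup>2 / real (p - 1)"
    using integral_dev_square_le[OF assms] by simp
qed

text \<open>Only the order matters. The constant is 4 + 18, obtained from the bound on
  \<open>dev\<close> with \<open>1 / (p - 1) \<le> 1\<close> and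
  \<open>j \<le> j\<^sup>2\<close>.\<close>

lemma integral_sq_square_le:
  assumes "j \<le> n"
  shows "(\<integral>\<omega>. (sq j \<omega>)\<^sup>2 \<partial>M) \<le> 22 * (real j)\<^sup>2"
proof -
  have int: "integrable M (\<lambda>\<omega>. (dev j \<omega>)\<^sup>2)" "integrable M (\<lambda>\<omega>. (sq j \<omega>)\<^sup>2)"
    by (intro integrable_ess_bounded ess_bounded_intros ess_bounded_dev ess_bounded_sq assms)+
  have "(\<integral>\<omega>. (sq j \<omega>)\<^sup>2 \<partial>M) \<le> (\<integral>\<omega>. 2 * (dev j \<omega>)\<^sup>2 + 2 * (real j)\<^sup>2 \<partial>M)"
  proof (rule integral_mono)
    fix \<omega>
    have "(sq j \<omega>)\<^sup>2 = (dev j \<omega> + real j * Q.f2)\<^sup>2" by (simp add: dev_def)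
    also have "\<dots> \<le> 2 * (dev j \<omega>)\<^sup>2 + 2 * (real j * Q.f2)\<^sup>2"
      using zero_le_power2[of "dev j \<omega> - real j * Q.f2"] by (simp add: power2_eq_square algebra_simps)
    also have "(real j * Q.f2)\<^sup>2 \<le> (real j * 1)\<^sup>2"
      using Q.f2_le_1 Q.f2_nonneg by (intro power_mono mult_left_mono) auto
    finally show "(sq j \<omega>)\<^sup>2 \<le> 2 * (dev j \<omega>)\<^sup>2 + 2 * (real j)\<^sup>2" by simp
  qed (use int in auto)
  also have "\<dots> = 2 * (\<integral>\<omega>. (dev j \<omega>)\<^sup>2 \<partial>M) + 2 * (real j)\<^sup>2"
    using int by (simp add: prob_space)
  also have "\<dots> \<le> 2 * (2 * real j + 8 * (real j)\<^sup>2 / real (p - 1)) + 2 * (real j)\<^sup>2"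
    using integral_dev_square_le[OF assms] by (simp only: add_le_cancel_right mult_le_cancel_left_pos zero_less_numeral)
  also have "8 * (real j)\<^sup>2 / real (p - 1) \<le> 8 * (real j)\<^sup>2 / 1"
    using Q.p_ge_2 by (intro divide_left_mono) auto
  finally have "(\<integral>\<omega>. (sq j \<omega>)\<^sup>2 \<partial>M) \<le> 4 * real j + 18 * (real j)\<^sup>2" by simp
  moreover have "real j \<le> (real j)\<^sup>2"
    by (cases j) (auto simp: power2_eq_square)
  ultimately show ?thesis by linarith
qed

end

section \<open>Characteristic function of the Rayleigh statistic\<close>

text \<open>The factors \<open>exp (- b j)\<close> are at most 1, so an error made at one step is
  not amplified later and the errors merely add up.\<close>

lemma recurrence_approx:
  fixes \<phi> :: "nat \<Rightarrow> complex"
  assumes "\<And>j. j < n \<Longrightarrow> cmod (\<phi> (Suc j) - of_real (exp (- b j)) * \<phi> j) \<le> \<epsilon>"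
    and "\<And>j. 0 \<le> b j" and "j \<le> n"
  shows "cmod (\<phi> j - of_real (exp (- (\<Sum>i<j. b i))) * \<phi> 0) \<le> real j * \<epsilon>"
  using assms(3)
proof (induction j)
  case 0
  show ?case by simp
next
  case (Suc j)
  let ?r = "of_real (exp (- b j)) :: complex"
  have "\<phi> (Suc j) - of_real (exp (- (\<Sum>i<Suc j. b i))) * \<phi> 0 =
      (\<phi> (Suc j) - ?r * \<phi> j) + ?r * (\<phi> j - of_real (exp (- (\<Sum>i<j. b i))) * \<phi> 0)"
    by (simp add: exp_add exp_diff exp_minus divide_inverse algebra_simps)
  also have "cmod \<dots> \<le> \<epsilon> + 1 * (real j * \<epsilon>)"
  proof (rule norm_triangle_mono[OF assms(1)])
    show "cmod (?r * (\<phi> j - of_real (exp (- (\<Sum>i<j. b i))) * \<phi> 0)) \<le> 1 * (real j * \<epsilon>)"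
      unfolding norm_mult using Suc assms(2)[of j] by (intro mult_mono) auto
  qed (use Suc in auto)
  finally show ?case by (simp add: algebra_simps)
qed

context rot_sample
begin

lemma integrable_iexp_mult:
  assumes "ess_bounded M g"
  shows "integrable M (\<lambda>\<omega>. iexp (s * g \<omega>))"
  using assms by (intro integrable_iexp) (auto simp: ess_bounded_def)

text \<open>Given the past, the new increment contributes the random factor
  \<open>\<psi> (psum (obs \<omega>) j)\<close>, which is close to
  \<open>1 - c * sq j \<omega> / 2\<close>, and \<open>b\<close> is the mean of
  \<open>c * sq j \<omega> / 2\<close>. The three error terms account, in this order, for
  \<open>1 - b\<close> against \<open>exp (- b)\<close>, for \<open>sq j\<close> against its mean,
  and for the Taylor remainder.\<close>

lemma char_step:
  fixes s :: real
  assumes j: "j < n"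
  defines "c \<equiv> s\<^sup>2 * Q.f2 / real (p - 1)"
  defines "b \<equiv> c * (real j * Q.f2) / 2"
  shows "cmod ((\<integral>\<omega>. iexp (s * pair_sum p (obs \<omega>) (Suc j)) \<partial>M) -
      of_real (exp (- b)) * (\<integral>\<omega>. iexp (s * pair_sum p (obs \<omega>) j) \<partial>M))
    \<le> b\<^sup>2 / 2 + c / 2 * (\<integral>\<omega>. \<bar>dev j \<omega>\<bar> \<partial>M) + s^4 / 8 / (real (p - 1))\<^sup>2 * (\<integral>\<omega>. (sq j \<omega>)\<^sup>2 \<partial>M)"
proof -
  define \<psi> where "\<psi> a = (\<integral>x. iexp (s * tail_dot p x a) \<partial>Q)" for a
  define E where "E \<omega> = iexp (s * pair_sum p (obs \<omega>) j)" for \<omega>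
  \<comment> \<open>Kept as a product, so that the factor belonging to the past leaves the inner
    integral.\<close>
  define f where "f = (\<lambda>z. iexp (s * pair_sum p (fst z) j) * iexp (s * tail_dot p (snd z) (psum (fst z) j)))"
  have c0: "0 \<le> c" and b0: "0 \<le> b"
    unfolding b_def c_def using Q.f2_nonneg by auto
  have past: "f (restrict z {1..j}, x) = f (z, x)" for z x
    by (simp add: f_def psum_restrict pair_sum_restrict del: One_nat_def)
  have [measurable]: "(\<lambda>z. tail_dot p (snd z) (psum (fst z) j)) \<in>
      borel_measurable (PiM {1..j} (\<lambda>_. borel_vec p) \<Otimes>\<^sub>M borel_vec p)"
    by (intro path_measurable_intros) auto
  have [measurable]: "(\<lambda>z. pair_sum p (fst z) j) \<in>
      borel_measurable (PiM {1..j} (\<lambda>_. borel_vec p) \<Otimes>\<^sub>M borel_vec p)"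
    by (rule borel_measurable_pair_sum)
  have meas: "f \<in> borel_measurable (PiM {1..j} (\<lambda>_. borel_vec p) \<Otimes>\<^sub>M borel_vec p)"
    unfolding f_def by measurable
  have f_Suc: "f (obs \<omega>, obs \<omega> (Suc j)) = iexp (s * pair_sum p (obs \<omega>) (Suc j))" for \<omega>
    by (simp add: f_def pair_sum_def exp_add[symmetric] algebra_simps)
  have int: "integrable M (\<lambda>\<omega>. f (obs \<omega>, obs \<omega> (Suc j)))"
    unfolding f_Suc using j by (intro integrable_iexp_mult ess_bounded_pair_sum) auto
  have inner: "(\<integral>x. f (obs \<omega>, x) \<partial>Q) = E \<omega> * \<psi> (psum (obs \<omega>) j)" for \<omega>
    by (simp add: f_def E_def \<psi>_def)
  have int_E\<psi>: "integrable M (\<lambda>\<omega>. E \<omega> * \<psi> (psum (obs \<omega>) j))"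
    using integral_step(1)[OF j meas past int] by (simp add: inner)
  have int_E: "integrable M E"
    unfolding E_def using j by (intro integrable_iexp_mult ess_bounded_pair_sum) auto
  have int_dev: "integrable M (\<lambda>\<omega>. \<bar>dev j \<omega>\<bar>)" and int_sq: "integrable M (\<lambda>\<omega>. (sq j \<omega>)\<^sup>2)"
    using j by (intro integrable_ess_bounded ess_bounded_intros ess_bounded_dev ess_bounded_sq; simp)+
  have "(\<integral>\<omega>. iexp (s * pair_sum p (obs \<omega>) (Suc j)) \<partial>M) = (\<integral>\<omega>. E \<omega> * \<psi> (psum (obs \<omega>) j) \<partial>M)"
    using integral_step(2)[OF j meas past int] by (simp add: inner f_Suc)
  then have "(\<integral>\<omega>. iexp (s * pair_sum p (obs \<omega>) (Suc j)) \<partial>M) - of_real (exp (- b)) * (\<integral>\<omega>. E \<omega> \<partial>M) =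
      (\<integral>\<omega>. E \<omega> * \<psi> (psum (obs \<omega>) j) - of_real (exp (- b)) * E \<omega> \<partial>M)"
    using int_E\<psi> int_E by simp
  also have "cmod \<dots> \<le> (\<integral>\<omega>. cmod (E \<omega> * \<psi> (psum (obs \<omega>) j) - of_real (exp (- b)) * E \<omega>) \<partial>M)"
    by (rule integral_norm_bound)
  also have "\<dots> \<le> (\<integral>\<omega>. b\<^sup>2 / 2 + c / 2 * \<bar>dev j \<omega>\<bar> + s^4 / 8 / (real (p - 1))\<^sup>2 * (sq j \<omega>)\<^sup>2 \<partial>M)"
  proof (rule integral_mono)
    fix \<omega>
    let ?a = "psum (obs \<omega>) j"
    \<comment> \<open>\<open>E \<omega>\<close> has modulus 1 and drops out of the norm.\<close>
    have "E \<omega> * \<psi> ?a - of_real (exp (- b)) * E \<omega> = E \<omega> * (\<psi> ?a - of_real (exp (- b)))"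
      by (simp add: algebra_simps)
    then have "cmod (E \<omega> * \<psi> ?a - of_real (exp (- b)) * E \<omega>) = cmod (\<psi> ?a - of_real (exp (- b)))"
      by (simp add: norm_mult E_def)
    also have "\<psi> ?a - of_real (exp (- b)) =
        (\<psi> ?a - of_real (1 - c * sq j \<omega> / 2)) + of_real ((1 - b - exp (- b)) - c / 2 * dev j \<omega>)"
      by (simp add: dev_def b_def algebra_simps)
    also have "cmod \<dots> \<le> s^4 / 8 / (real (p - 1))\<^sup>2 * (sq j \<omega>)\<^sup>2 + (b\<^sup>2 / 2 + c / 2 * \<bar>dev j \<omega>\<bar>)"
    proof (rule norm_triangle_mono)
      show "cmod (\<psi> ?a - of_real (1 - c * sq j \<omega> / 2)) \<le> s^4 / 8 / (real (p - 1))\<^sup>2 * (sq j \<omega>)\<^sup>2"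
        using Q.integral_iexp_tail_dot_approx[of s ?a] by (simp add: \<psi>_def c_def sq_def)
      have "\<bar>(1 - b - exp (- b)) - c / 2 * dev j \<omega>\<bar> \<le> \<bar>1 - b - exp (- b)\<bar> + \<bar>c / 2 * dev j \<omega>\<bar>"
        by (rule abs_triangle_ineq4)
      also have "\<dots> \<le> b\<^sup>2 / 2 + c / 2 * \<bar>dev j \<omega>\<bar>"
        using exp_minus_bound[OF b0] c0 by (simp add: abs_mult)
      finally show "cmod (of_real ((1 - b - exp (- b)) - c / 2 * dev j \<omega>)) \<le> b\<^sup>2 / 2 + c / 2 * \<bar>dev j \<omega>\<bar>"
        unfolding norm_of_real .
    qed
    finally show "cmod (E \<omega> * \<psi> ?a - of_real (exp (- b)) * E \<omega>) \<le>
        b\<^sup>2 / 2 + c / 2 * \<bar>dev j \<omega>\<bar> + s^4 / 8 / (real (p - 1))\<^sup>2 * (sq j \<omega>)\<^sup>2"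
      by simp
  qed (use int_E int_E\<psi> int_dev int_sq in auto)
  also have "\<dots> = b\<^sup>2 / 2 + c / 2 * (\<integral>\<omega>. \<bar>dev j \<omega>\<bar> \<partial>M) + s^4 / 8 / (real (p - 1))\<^sup>2 * (\<integral>\<omega>. (sq j \<omega>)\<^sup>2 \<partial>M)"
    using int_dev int_sq by (simp add: prob_space)
  finally show ?thesis by (simp add: E_def)
qed

definition \<kappa> :: real where "\<kappa> = sqrt (2 * real p) / real n"

text \<open>Each of the \<open>n\<close> steps loses at most \<open>\<epsilon>\<close>; the constant
  46 is 2 from the square of \<open>b j\<close> plus 44 from the Taylor remainder. The exponent is
  the exact sum of the \<open>b j\<close>: apart from \<open>t\<^sup>2 / 2\<close> it consists of
  factors that tend to 1 in the final limit.\<close>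

lemma char_pair_sum_approx:
  "cmod ((\<integral>\<omega>. iexp (t * (\<kappa> * pair_sum p (obs \<omega>) n)) \<partial>M) -
      of_real (exp (- (t\<^sup>2 / 2 * (real p / real (p - 1)) * Q.f2\<^sup>2 * (real (n - 1) / real n)))))
    \<le> 46 * t^4 / real n + 2 * t\<^sup>2 * sqrt (2 / real n + 8 / real (p - 1))"
proof -
  define q where "q = real (p - 1)"
  define N where "N = real n"
  define s where "s = t * \<kappa>"
  define c where "c = s\<^sup>2 * Q.f2 / q"
  define b where "b j = c * (real j * Q.f2) / 2" for j :: nat
  define D where "D = sqrt (2 / N + 8 / q)"
  define \<epsilon> where "\<epsilon> = 46 * t^4 / N\<^sup>2 + 2 * t\<^sup>2 * D / N"
  define \<phi> where "\<phi> j = (\<integral>\<omega>. iexp (s * pair_sum p (obs \<omega>) j) \<partial>M)" for j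
  have q1: "1 \<le> q" and pq: "real p \<le> 2 * q" and N1: "1 \<le> N"
    using Q.p_ge_2 n_pos by (auto simp: q_def N_def)
  have s2: "s\<^sup>2 = t\<^sup>2 * (2 * real p / N\<^sup>2)"
    by (simp add: s_def \<kappa>_def N_def power_mult_distrib power_divide)
  \<comment> \<open>\<open>p \<le> 2 * (p - 1)\<close> makes the bound uniform in the
    dimension.\<close>
  have s2q: "s\<^sup>2 / q \<le> 4 * t\<^sup>2 / N\<^sup>2"
  proof -
    have "real p / q \<le> 2" using pq q1 by (simp add: field_simps)
    then have "2 * t\<^sup>2 / N\<^sup>2 * (real p / q) \<le> 2 * t\<^sup>2 / N\<^sup>2 * 2"
      by (intro mult_left_mono) auto
    then show ?thesis by (simp add: s2 mult_ac)
  qed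
  have c_le: "c \<le> 4 * t\<^sup>2 / N\<^sup>2"
  proof -
    have "c = s\<^sup>2 / q * Q.f2" by (simp add: c_def)
    also have "\<dots> \<le> s\<^sup>2 / q * 1"
      using Q.f2_le_1 q1 by (intro mult_left_mono) auto
    finally show ?thesis using s2q by simp
  qed
  have c0: "0 \<le> c" using Q.f2_nonneg q1 by (simp add: c_def)
  have b0: "0 \<le> b j" for j using c0 Q.f2_nonneg by (simp add: b_def)
  have step: "cmod (\<phi> (Suc j) - of_real (exp (- b j)) * \<phi> j) \<le> \<epsilon>" if j: "j < n" for j
  proof -
    have jN: "real j \<le> N" using j by (simp add: N_def)
    have "b j \<le> 4 * t\<^sup>2 / N\<^sup>2 * (N * 1) / 2"
      unfolding b_def using c_le jN Q.f2_le_1 Q.f2_nonneg c0 N1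
      by (intro divide_right_mono mult_mono) auto
    also have "\<dots> = 2 * t\<^sup>2 / N" using N1 by (simp add: power2_eq_square)
    finally have "(b j)\<^sup>2 \<le> (2 * t\<^sup>2 / N)\<^sup>2"
      using b0 by (intro power_mono)
    then have b2: "(b j)\<^sup>2 / 2 \<le> 2 * t^4 / N\<^sup>2"
      by (simp add: power_divide power_mult_distrib)
    have "(\<integral>\<omega>. \<bar>dev j \<omega>\<bar> \<partial>M) \<le> sqrt (2 * real j + 8 * (real j)\<^sup>2 / q)"
      unfolding q_def using j by (intro integral_abs_dev_le) simp
    also have "\<dots> \<le> sqrt (2 * N + 8 * N\<^sup>2 / q)"
      using jN q1 by (intro real_sqrt_le_mono add_mono mult_left_mono divide_right_mono power_mono) auto
    \<comment> \<open>Factoring out \<open>N\<^sup>2\<close> isolates \<open>D\<close>, the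
      deviation relative to \<open>N\<close>, which vanishes as both \<open>N\<close> and
      \<open>q\<close> grow.\<close>
    also have "2 * N + 8 * N\<^sup>2 / q = N\<^sup>2 * (2 / N + 8 / q)"
      using N1 by (simp add: power2_eq_square field_simps)
    also have "sqrt \<dots> = N * D"
      using N1 by (simp add: real_sqrt_mult D_def)
    finally have "c / 2 * (\<integral>\<omega>. \<bar>dev j \<omega>\<bar> \<partial>M) \<le> (4 * t\<^sup>2 / N\<^sup>2) / 2 * (N * D)"
      using c_le c0 by (intro mult_mono divide_right_mono) auto
    also have "\<dots> = 2 * t\<^sup>2 * D / N" using N1 by (simp add: power2_eq_square)
    finally have dev: "c / 2 * (\<integral>\<omega>. \<bar>dev j \<omega>\<bar> \<partial>M) \<le> 2 * t\<^sup>2 * D / N" .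
    have "(\<integral>\<omega>. (sq j \<omega>)\<^sup>2 \<partial>M) \<le> 22 * (real j)\<^sup>2"
      using j by (intro integral_sq_square_le) simp
    also have "\<dots> \<le> 22 * N\<^sup>2"
      using jN by (intro mult_left_mono power_mono) auto
    finally have "s^4 / 8 / q\<^sup>2 * (\<integral>\<omega>. (sq j \<omega>)\<^sup>2 \<partial>M) \<le> s^4 / 8 / q\<^sup>2 * (22 * N\<^sup>2)"
      by (intro mult_left_mono) auto
    also have "\<dots> = (s\<^sup>2 / q)\<^sup>2 * (22 / 8 * N\<^sup>2)"
      by (simp add: power_divide mult_ac)
    also have "\<dots> \<le> (4 * t\<^sup>2 / N\<^sup>2)\<^sup>2 * (22 / 8 * N\<^sup>2)"
      using s2q q1 by (intro mult_right_mono power_mono) auto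
    also have "\<dots> = 44 * t^4 / N\<^sup>2"
      using N1 by (simp add: field_simps power2_eq_square power4_eq_xxxx)
    finally have sq: "s^4 / 8 / q\<^sup>2 * (\<integral>\<omega>. (sq j \<omega>)\<^sup>2 \<partial>M) \<le> 44 * t^4 / N\<^sup>2" .
    have "cmod (\<phi> (Suc j) - of_real (exp (- b j)) * \<phi> j) \<le>
        (b j)\<^sup>2 / 2 + c / 2 * (\<integral>\<omega>. \<bar>dev j \<omega>\<bar> \<partial>M) + s^4 / 8 / q\<^sup>2 * (\<integral>\<omega>. (sq j \<omega>)\<^sup>2 \<partial>M)"
      using char_step[OF j, of s] by (simp add: \<phi>_def b_def c_def q_def)
    also have "\<dots> \<le> 2 * t^4 / N\<^sup>2 + 2 * t\<^sup>2 * D / N + 44 * t^4 / N\<^sup>2"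
      by (intro add_mono b2 dev sq)
    also have "\<dots> = \<epsilon>" by (simp add: \<epsilon>_def)
    finally show ?thesis .
  qed
  have sum_b: "(\<Sum>i<n. b i) = t\<^sup>2 / 2 * (real p / q) * Q.f2\<^sup>2 * (real (n - 1) / N)"
  proof -
    \<comment> \<open>The truncated \<open>m - 1\<close> is harmless at 0, where it is multiplied by
      0.\<close>
    have "2 * (\<Sum>i<m. real i) = real m * real (m - 1)" for m
    proof (induction m)
      case (Suc m)
      then show ?case by (cases m) (auto simp: algebra_simps)
    qed simp
    from this[of n] have *: "(\<Sum>i<n. real i) = N * real (n - 1) / 2" by (simp add: N_def)
    have "(\<Sum>i<n. b i) = (c * Q.f2 / 2) * (\<Sum>i<n. real i)"
      unfolding sum_distrib_left by (intro sum.cong) (auto simp: b_def)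
    also have "\<dots> = t\<^sup>2 / 2 * (real p / q) * Q.f2\<^sup>2 * (real (n - 1) / N)"
      unfolding * c_def s2 using N1 by (simp add: power2_eq_square mult_ac)
    finally show ?thesis .
  qed
  have \<phi>0: "\<phi> 0 = 1" by (simp add: \<phi>_def pair_sum_def prob_space)
  have "cmod (\<phi> n - of_real (exp (- (\<Sum>i<n. b i))) * \<phi> 0) \<le> N * \<epsilon>"
    unfolding N_def using step b0 by (intro recurrence_approx[where n = n]) auto
  also have "N * \<epsilon> = 46 * t^4 / N + 2 * t\<^sup>2 * D"
    using N1 by (simp add: \<epsilon>_def power2_eq_square algebra_simps)
  finally show ?thesis
    unfolding \<phi>0 sum_b by (simp add: \<phi>_def s_def N_def q_def D_def mult.assoc)
qed

section \<open>Contribution of the first coordinates\<close>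

definition e1 :: real where "e1 = (\<integral>x. x 0 \<partial>Q)"

definition v :: real where "v = (\<integral>x. (x 0 - e1)\<^sup>2 \<partial>Q)"

lemma p_pos: "0 < p" using Q.p_ge_2 by simp

lemma integral_head_square: "(\<integral>x. (x 0)\<^sup>2 \<partial>Q) = v + e1\<^sup>2"
proof -
  have i: "integrable Q (\<lambda>x. x 0)" "integrable Q (\<lambda>x. (x 0)\<^sup>2)"
    using p_pos by (intro Q.integrable_ess_bounded ess_bounded_intros Q.ess_bounded_coord; simp)+
  then show ?thesis
    unfolding v_def e1_def using Q.variance_eq[of "\<lambda>x. x 0"] by simp
qed

text \<open>The unit norm ties the tail to the first coordinate: once \<open>v\<close> and
  \<open>e1\<close> tend to 0, \<open>f2\<close> tends to 1, which produces unit variance in the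
  limit.\<close>

lemma f2_eq: "Q.f2 = 1 - v - e1\<^sup>2"
  using Q.f2_eq integral_head_square by simp

definition head_sum :: "nat \<Rightarrow> 'a \<Rightarrow> real" where
  "head_sum j \<omega> = (\<Sum>i\<in>{1..j}. obs \<omega> i 0 - e1)"

lemma ess_bounded_head_sum: "j \<le> n \<Longrightarrow> ess_bounded M (head_sum j)"
  unfolding head_sum_def[abs_def] using p_pos by (intro ess_bounded_intros ess_bounded_obs) auto

lemma integral_head_sum_square: "j \<le> n \<Longrightarrow> (\<integral>\<omega>. (head_sum j \<omega>)\<^sup>2 \<partial>M) = real j * v"
proof (induction j)
  case 0
  show ?case by (simp add: head_sum_def)
next
  case (Suc j)
  then have j: "j < n" by simp
  define h where "h z = (\<Sum>i\<in>{1..j}. z i 0 - e1)" for z :: "nat \<Rightarrow> nat \<Rightarrow> real"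
  define f where "f = (\<lambda>z. (h (fst z) + (snd z (0::nat) - e1))\<^sup>2)"
  have "(\<integral>\<omega>. (head_sum (Suc j) \<omega>)\<^sup>2 \<partial>M) = (\<integral>\<omega>. f (obs \<omega>, obs \<omega> (Suc j)) \<partial>M)"
    by (simp add: f_def h_def head_sum_def)
  also have "\<dots> = (\<integral>\<omega>. (\<integral>x. f (obs \<omega>, x) \<partial>Q) \<partial>M)"
  proof (rule integral_step(2)[OF j])
    show "f \<in> borel_measurable (PiM {1..j} (\<lambda>_. borel_vec p) \<Otimes>\<^sub>M borel_vec p)"
      unfolding f_def h_def using p_pos
      by (intro borel_measurable_power borel_measurable_add borel_measurable_sum borel_measurable_diff
          borel_measurable_const path_measurable_intros) auto
    show "f (restrict z {1..j}, x) = f (z, x)" for z x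
      by (simp add: f_def h_def)
    show "integrable M (\<lambda>\<omega>. f (obs \<omega>, obs \<omega> (Suc j)))"
      using j p_pos unfolding f_def h_def by (simp, intro integrable_intros) auto
  qed
  also have "(\<lambda>\<omega>. \<integral>x. f (obs \<omega>, x) \<partial>Q) = (\<lambda>\<omega>. (head_sum j \<omega>)\<^sup>2 + v)"
  proof
    fix \<omega>
    have i: "integrable Q (\<lambda>x. x 0)" "integrable Q (\<lambda>x. (x 0 - e1)\<^sup>2)"
      using p_pos by (intro Q.integrable_ess_bounded ess_bounded_intros Q.ess_bounded_coord; simp)+
    have "f (obs \<omega>, x) = (head_sum j \<omega>)\<^sup>2 + 2 * head_sum j \<omega> * (x 0 - e1) + (x 0 - e1)\<^sup>2" for x
      by (simp add: f_def h_def head_sum_def power2_sum)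
    then have "(\<integral>x. f (obs \<omega>, x) \<partial>Q) =
        (head_sum j \<omega>)\<^sup>2 + 2 * head_sum j \<omega> * ((\<integral>x. x 0 \<partial>Q) - e1) + v"
      unfolding v_def using i by (simp add: Q.prob_space)
    then show "(\<integral>x. f (obs \<omega>, x) \<partial>Q) = (head_sum j \<omega>)\<^sup>2 + v"
      by (simp add: e1_def)
  qed
  also have "(\<integral>\<omega>. (head_sum j \<omega>)\<^sup>2 + v \<partial>M) = (\<integral>\<omega>. (head_sum j \<omega>)\<^sup>2 \<partial>M) + v"
    using j integrable_ess_bounded[OF ess_bounded_power[OF ess_bounded_head_sum], of j]
    by (simp add: prob_space)
  finally show ?case using Suc by (simp add: algebra_simps)
qed

lemma integral_abs_head_sum_le: "(\<integral>\<omega>. \<bar>head_sum n \<omega>\<bar> \<partial>M) \<le> sqrt (real n * v)"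
proof (rule real_le_rsqrt)
  have "integrable M (\<lambda>\<omega>. \<bar>head_sum n \<omega>\<bar>)" "integrable M (\<lambda>\<omega>. (\<bar>head_sum n \<omega>\<bar>)\<^sup>2)"
    by (intro integrable_ess_bounded ess_bounded_intros ess_bounded_head_sum order_refl)+
  then have "(\<integral>\<omega>. \<bar>head_sum n \<omega>\<bar> \<partial>M)\<^sup>2 \<le> (\<integral>\<omega>. \<bar>head_sum n \<omega>\<bar>\<^sup>2 \<partial>M)"
    using variance_eq[of "\<lambda>\<omega>. \<bar>head_sum n \<omega>\<bar>"] variance_positive[of "\<lambda>\<omega>. \<bar>head_sum n \<omega>\<bar>"] by simp
  then show "(\<integral>\<omega>. \<bar>head_sum n \<omega>\<bar> \<partial>M)\<^sup>2 \<le> real n * v"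
    using integral_head_sum_square[of n] by simp
qed

lemma rayleigh_st_eq:
  "rayleigh_st n p X \<omega> = sqrt (real p / 2) / real n *
     ((psum (obs \<omega>) n 0)\<^sup>2 + sq n \<omega> - real n)"
proof -
  let ?r = "sqrt (real p / 2)"
  have m: "sample_mean n p X \<omega> k = psum (obs \<omega>) n k / real n" if "k < p" for k
    using that by (simp add: sample_mean_def psum_def obs_def)
  have "(L2_set (sample_mean n p X \<omega>) {..<p})\<^sup>2 = (\<Sum>k<p. (psum (obs \<omega>) n k / real n)\<^sup>2)"
    unfolding L2_set_def by (simp add: sum_nonneg m)
  also have "\<dots> = (\<Sum>k<p. (psum (obs \<omega>) n k)\<^sup>2) / (real n)\<^sup>2"
    by (simp add: power_divide sum_divide_distrib)
  also have "(\<Sum>k<p. (psum (obs \<omega>) n k)\<^sup>2) = (psum (obs \<omega>) n 0)\<^sup>2 + sq n \<omega>"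
    using p_pos by (simp add: lessThan_atLeast0 sum.atLeast_Suc_lessThan sq_def tail_dot_def power2_eq_square)
  finally have L: "(L2_set (sample_mean n p X \<omega>) {..<p})\<^sup>2 =
      ((psum (obs \<omega>) n 0)\<^sup>2 + sq n \<omega>) / (real n)\<^sup>2" .
  have r: "real p / sqrt (2 * real p) = ?r"
    using p_pos by (simp add: real_sqrt_mult real_sqrt_divide field_simps)
  have "rayleigh_st n p X \<omega> = real p / sqrt (2 * real p) *
      (((psum (obs \<omega>) n 0)\<^sup>2 + sq n \<omega>) / real n - 1)"
  proof -
    have "(real n * real p * (A / (real n)\<^sup>2) - real p) / y = real p / y * (A / real n - 1)" for A y
      using n_pos by (simp add: power2_eq_square right_diff_distrib diff_divide_distrib)
    then show ?thesis unfolding rayleigh_st_def L .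
  qed
  also have "\<dots> = ?r / real n * ((psum (obs \<omega>) n 0)\<^sup>2 + sq n \<omega> - real n)"
    unfolding r using n_pos by (simp add: field_simps)
  finally show ?thesis .
qed

lemma ess_bounded_rayleigh_st: "ess_bounded M (rayleigh_st n p X)"
  unfolding rayleigh_st_eq[abs_def] using p_pos by (intro ess_bounded_mult ess_bounded_const
    ess_bounded_diff ess_bounded_add ess_bounded_power ess_bounded_psum ess_bounded_sq) auto

text \<open>By the unit norm the squared tail lengths add up to \<open>n\<close> minus the squared
  first coordinates, which cancels the centering of the statistic. Expanding the sum of the first
  coordinates about \<open>n * e1\<close> then isolates the drift
  \<open>sqrt (p / 2) * (n * e1\<^sup>2)\<close>, the source of
  \<open>\<tau>\<^sup>2 / sqrt 2\<close>.\<close>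

lemma AE_rayleigh_st_eq:
  "AE \<omega> in M. rayleigh_st n p X \<omega> = \<kappa> * pair_sum p (obs \<omega>) n + sqrt (real p / 2) *
     (real n * e1\<^sup>2 + 2 * e1 * head_sum n \<omega> + (head_sum n \<omega>)\<^sup>2 / real n
      - (\<Sum>i\<in>{1..n}. (obs \<omega> i 0)\<^sup>2) / real n)"
proof -
  have "AE \<omega> in M. \<forall>i\<in>{1..n}. tail_dot p (obs \<omega> i) (obs \<omega> i) = 1 - (obs \<omega> i 0)\<^sup>2"
    unfolding obs_def by (intro AE_finite_allI AE_X Q.AE_tail_dot_self) auto
  then show ?thesis
  proof eventually_elim
    case (elim \<omega>)
    have "sqrt (2 * real p) = 2 * sqrt (real p / 2)"
      by (rule real_sqrt_unique) (simp_all add: power_mult_distrib)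
    then have \<kappa>: "\<kappa> = 2 * sqrt (real p / 2) / real n"
      by (simp add: \<kappa>_def)
    have "(\<Sum>i\<in>{1..n}. tail_dot p (obs \<omega> i) (obs \<omega> i)) = (\<Sum>i\<in>{1..n}. 1 - (obs \<omega> i 0)\<^sup>2)"
      using elim by (intro sum.cong) auto
    then have sq: "sq n \<omega> = real n - (\<Sum>i\<in>{1..n}. (obs \<omega> i 0)\<^sup>2) + 2 * pair_sum p (obs \<omega>) n"
      by (simp add: sq_def tail_dot_psum_self sum_subtractf)
    have u: "psum (obs \<omega>) n 0 = real n * e1 + head_sum n \<omega>"
      by (simp add: psum_def head_sum_def sum_subtractf)
    show ?case
      unfolding rayleigh_st_eq sq u \<kappa> using n_pos
      by (simp add: power2_sum power_mult_distrib) (simp add: field_simps power2_eq_square)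
  qed
qed

text \<open>In \<open>2 * v + e1\<^sup>2\<close> one \<open>v\<close> comes from the squared head
  sum and \<open>v + e1\<^sup>2\<close> from the individual squares. At the rates of the theorem,
  the three terms in the last bracket, times \<open>sqrt (p / 2)\<close>, are of order at most
  \<open>p powr (- 1/4)\<close>, \<open>p powr (- 1/2)\<close> and \<open>1 / n\<close>.\<close>

lemma integral_rayleigh_st_error_le:
  "(\<integral>\<omega>. \<bar>rayleigh_st n p X \<omega> - \<mu> - \<kappa> * pair_sum p (obs \<omega>) n\<bar> \<partial>M) \<le>
     \<bar>sqrt (real p / 2) * (real n * e1\<^sup>2) - \<mu>\<bar> +
     sqrt (real p / 2) * (2 * \<bar>e1\<bar> * sqrt (real n * v) + 2 * v + e1\<^sup>2)"
proof -
  let ?r = "sqrt (real p / 2)"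
  let ?W = "\<lambda>\<omega>. \<Sum>i\<in>{1..n}. (obs \<omega> i 0)\<^sup>2"
  have i1: "integrable M (\<lambda>\<omega>. \<bar>rayleigh_st n p X \<omega> - \<mu> - \<kappa> * pair_sum p (obs \<omega>) n\<bar>)"
    by (intro integrable_ess_bounded ess_bounded_abs ess_bounded_diff ess_bounded_const
        ess_bounded_mult ess_bounded_rayleigh_st ess_bounded_pair_sum order_refl)
  have i2: "integrable M (\<lambda>\<omega>. \<bar>head_sum n \<omega>\<bar>)" "integrable M (\<lambda>\<omega>. (head_sum n \<omega>)\<^sup>2)"
    by (intro integrable_ess_bounded ess_bounded_intros ess_bounded_head_sum order_refl)+
  have i4: "integrable M (\<lambda>\<omega>. (obs \<omega> i 0)\<^sup>2)" if "i \<in> {1..n}" for i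
    using p_pos that by (intro integrable_ess_bounded ess_bounded_intros ess_bounded_obs)
  then have i3: "integrable M ?W"
    by (intro Bochner_Integration.integrable_sum)
  have "(\<integral>\<omega>. ?W \<omega> \<partial>M) = (\<Sum>i\<in>{1..n}. \<integral>\<omega>. (obs \<omega> i 0)\<^sup>2 \<partial>M)"
    by (intro Bochner_Integration.integral_sum i4)
  also have "\<dots> = (\<Sum>i\<in>{1..n}. v + e1\<^sup>2)"
  proof (intro sum.cong refl)
    fix i assume "i \<in> {1..n}"
    then have "(\<integral>\<omega>. (obs \<omega> i 0)\<^sup>2 \<partial>M) = (\<integral>x. (x 0)\<^sup>2 \<partial>Q)"
      unfolding obs_def using p_pos by (intro integral_X) auto
    then show "(\<integral>\<omega>. (obs \<omega> i 0)\<^sup>2 \<partial>M) = v + e1\<^sup>2"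
      by (simp add: integral_head_square)
  qed
  finally have W: "(\<integral>\<omega>. ?W \<omega> \<partial>M) = real n * (v + e1\<^sup>2)" by simp
  have "(\<integral>\<omega>. \<bar>rayleigh_st n p X \<omega> - \<mu> - \<kappa> * pair_sum p (obs \<omega>) n\<bar> \<partial>M) \<le>
      (\<integral>\<omega>. \<bar>?r * (real n * e1\<^sup>2) - \<mu>\<bar> + ?r * (2 * \<bar>e1\<bar> * \<bar>head_sum n \<omega>\<bar> +
        (head_sum n \<omega>)\<^sup>2 / real n + ?W \<omega> / real n) \<partial>M)"
  proof (rule integral_mono_AE[OF i1])
    show "AE \<omega> in M. \<bar>rayleigh_st n p X \<omega> - \<mu> - \<kappa> * pair_sum p (obs \<omega>) n\<bar> \<le>
        \<bar>?r * (real n * e1\<^sup>2) - \<mu>\<bar> + ?r * (2 * \<bar>e1\<bar> * \<bar>head_sum n \<omega>\<bar> +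
          (head_sum n \<omega>)\<^sup>2 / real n + ?W \<omega> / real n)"
      using AE_rayleigh_st_eq
    proof eventually_elim
      case (elim \<omega>)
      let ?h = "head_sum n \<omega>"
      let ?d = "2 * e1 * ?h + ?h\<^sup>2 / real n - ?W \<omega> / real n"
      have "rayleigh_st n p X \<omega> - \<mu> - \<kappa> * pair_sum p (obs \<omega>) n = (?r * (real n * e1\<^sup>2) - \<mu>) + ?r * ?d"
        unfolding elim by (simp add: algebra_simps)
      also have "\<bar>\<dots>\<bar> \<le> \<bar>?r * (real n * e1\<^sup>2) - \<mu>\<bar> + ?r * \<bar>?d\<bar>"
        by (rule order_trans[OF abs_triangle_ineq]) (simp add: abs_mult)
      also have "\<bar>?d\<bar> \<le> 2 * \<bar>e1\<bar> * \<bar>?h\<bar> + ?h\<^sup>2 / real n + ?W \<omega> / real n"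
      proof -
        have "\<bar>2 * e1 * ?h\<bar> = 2 * \<bar>e1\<bar> * \<bar>?h\<bar>" by (simp add: abs_mult)
        moreover have "0 \<le> ?h\<^sup>2 / real n" "0 \<le> ?W \<omega> / real n"
          by (simp_all add: sum_nonneg)
        ultimately show ?thesis by linarith
      qed
      finally show ?case by (simp add: mult_left_mono)
    qed
  qed (use i2 i3 in \<open>auto simp del: sum.cl_ivl_Suc\<close>)
  also have "\<dots> = \<bar>?r * (real n * e1\<^sup>2) - \<mu>\<bar> + ?r * (2 * \<bar>e1\<bar> * (\<integral>\<omega>. \<bar>head_sum n \<omega>\<bar> \<partial>M) +
      (\<integral>\<omega>. (head_sum n \<omega>)\<^sup>2 \<partial>M) / real n + (\<integral>\<omega>. ?W \<omega> \<partial>M) / real n)"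
    using i2 i3 by (simp add: prob_space del: Bochner_Integration.integral_sum)
  also have "\<dots> = \<bar>?r * (real n * e1\<^sup>2) - \<mu>\<bar> + ?r * (2 * \<bar>e1\<bar> * (\<integral>\<omega>. \<bar>head_sum n \<omega>\<bar> \<partial>M) + 2 * v + e1\<^sup>2)"
    unfolding W using n_pos integral_head_sum_square[of n] by simp
  also have "\<dots> \<le> \<bar>?r * (real n * e1\<^sup>2) - \<mu>\<bar> + ?r * (2 * \<bar>e1\<bar> * sqrt (real n * v) + 2 * v + e1\<^sup>2)"
    using integral_abs_head_sum_le by (intro add_mono mult_left_mono order_refl) auto
  finally show ?thesis .
qed

text \<open>The map from \<open>u\<close> to \<open>iexp u\<close> is 1-Lipschitz, so passing from
  the centered statistic to the pair sum costs \<open>\<bar>t\<bar>\<close> times their mean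
  absolute difference.\<close>

lemma char_rayleigh_st_approx:
  "cmod (char (distr M borel (\<lambda>\<omega>. rayleigh_st n p X \<omega> - \<mu>)) t -
      of_real (exp (- (t\<^sup>2 / 2 * (real p / real (p - 1)) * Q.f2\<^sup>2 * (real (n - 1) / real n)))))
    \<le> \<bar>t\<bar> * (\<bar>sqrt (real p / 2) * (real n * e1\<^sup>2) - \<mu>\<bar> +
        sqrt (real p / 2) * (2 * \<bar>e1\<bar> * sqrt (real n * v) + 2 * v + e1\<^sup>2)) +
      (46 * t^4 / real n + 2 * t\<^sup>2 * sqrt (2 / real n + 8 / real (p - 1)))"
proof -
  define R where "R \<omega> = rayleigh_st n p X \<omega> - \<mu>" for \<omega>
  define T where "T \<omega> = \<kappa> * pair_sum p (obs \<omega>) n" for \<omega>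
  have R: "ess_bounded M R" and T: "ess_bounded M T"
    unfolding R_def[abs_def] T_def[abs_def]
    by (intro ess_bounded_diff ess_bounded_const ess_bounded_mult ess_bounded_rayleigh_st
        ess_bounded_pair_sum order_refl)+
  have [measurable]: "R \<in> borel_measurable M" using R by (simp add: ess_bounded_def)
  have int: "integrable M (\<lambda>\<omega>. iexp (t * R \<omega>))" "integrable M (\<lambda>\<omega>. iexp (t * T \<omega>))"
    by (intro integrable_iexp_mult R T)+
  have "char (distr M borel R) t - (\<integral>\<omega>. iexp (t * T \<omega>) \<partial>M) = (\<integral>\<omega>. iexp (t * R \<omega>) - iexp (t * T \<omega>) \<partial>M)"
    using int by (simp add: char_def integral_distr)
  also have "cmod \<dots> \<le> (\<integral>\<omega>. cmod (iexp (t * R \<omega>) - iexp (t * T \<omega>)) \<partial>M)"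
    by (rule integral_norm_bound)
  also have "\<dots> \<le> (\<integral>\<omega>. \<bar>t\<bar> * \<bar>R \<omega> - T \<omega>\<bar> \<partial>M)"
  proof (rule integral_mono)
    fix \<omega>
    have "iexp (t * R \<omega>) - iexp (t * T \<omega>) = iexp (t * T \<omega>) * (iexp (t * (R \<omega> - T \<omega>)) - 1)"
      by (simp add: algebra_simps exp_add[symmetric])
    then have "cmod (iexp (t * R \<omega>) - iexp (t * T \<omega>)) = cmod (iexp (t * (R \<omega> - T \<omega>)) - 1)"
      by (simp add: norm_mult)
    also have "\<dots> \<le> \<bar>t * (R \<omega> - T \<omega>)\<bar>"
      using iexp_approx1[of "t * (R \<omega> - T \<omega>)" 0] by simp
    finally show "cmod (iexp (t * R \<omega>) - iexp (t * T \<omega>)) \<le> \<bar>t\<bar> * \<bar>R \<omega> - T \<omega>\<bar>"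
      by (simp add: abs_mult)
  next
    show "integrable M (\<lambda>\<omega>. \<bar>t\<bar> * \<bar>R \<omega> - T \<omega>\<bar>)"
      by (intro integrable_ess_bounded ess_bounded_mult ess_bounded_const ess_bounded_abs
          ess_bounded_diff R T)
  qed (use int in auto)
  also have "\<dots> = \<bar>t\<bar> * (\<integral>\<omega>. \<bar>R \<omega> - T \<omega>\<bar> \<partial>M)" by simp
  also have "\<dots> \<le> \<bar>t\<bar> * (\<bar>sqrt (real p / 2) * (real n * e1\<^sup>2) - \<mu>\<bar> +
        sqrt (real p / 2) * (2 * \<bar>e1\<bar> * sqrt (real n * v) + 2 * v + e1\<^sup>2))"
    unfolding R_def T_def by (intro mult_left_mono integral_rayleigh_st_error_le) auto
  finally show ?thesis
    using norm_triangle_le[OF add_mono[OF _ char_pair_sum_approx[of t]]]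
    unfolding R_def[abs_def, symmetric] T_def[symmetric]
    by (smt (verit) norm_triangle_ineq add_diff_cancel_left' diff_add_cancel add_diff_eq)
qed

end

section \<open>Asymptotic power\<close>

lemma rot_sample_of_sample_hyp:
  assumes hyp: "sample_hyp n p F M X" and n: "1 \<le> n" and p: "2 \<le> p"
  shows "rot_sample M (distr M (borel_vec p) (X 1)) p n X"
proof -
  interpret prob_space M using hyp by (simp add: sample_hyp_def)
  define Q where "Q = distr M (borel_vec p) (X 1)"
  have 1: "1 \<in> {1..n}" using n by simp
  have indep: "indep_vars (\<lambda>_. borel_vec p) X {1..n}"
    using hyp by (simp add: sample_hyp_def)
  then have X [measurable]: "X 1 \<in> measurable M (borel_vec p)"
    using 1 unfolding indep_vars_def by blast
  interpret Q: prob_space Q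
    unfolding Q_def by (rule prob_space_distr) (rule X)
  have sets_Q [measurable_cong]: "sets Q = sets (borel_vec p)" by (simp add: Q_def)
  have distr: "distr M (borel_vec p) (X i) = Q" if "i \<in> {1..n}" for i
    using hyp that 1 unfolding sample_hyp_def Q_def by metis
  have "AE \<omega> in M. X 1 \<omega> \<in> unit_sphere p"
    using hyp 1 unfolding sample_hyp_def by blast
  then have "AE \<omega> in M. (\<Sum>k<p. (X 1 \<omega> k)\<^sup>2) = 1"
    by eventually_elim (simp add: unit_sphere_def L2_set_def)
  \<comment> \<open>Measurability of this set lets the almost sure norm condition pass to the image
    measure.\<close>
  moreover have "{x \<in> space (borel_vec p). (\<Sum>k<p. (x k)\<^sup>2) = 1} \<in> sets (borel_vec p)"
    by measurable
  ultimately have norm: "AE x in Q. (\<Sum>k<p. (x k)\<^sup>2) = 1"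
    unfolding Q_def by (subst AE_distr_iff[OF X]) auto
  have sym: "rot_symmetric M p (first_basis p) (X 1)"
    using hyp 1 unfolding sample_hyp_def by blast
  have inv: "distr Q (borel_vec p) (mat_app p A) = Q"
    if "orthogonal_mat p A" "mat_app p A (first_basis p) = first_basis p" for A
  proof -
    have [measurable]: "mat_app p A \<in> measurable (borel_vec p) (borel_vec p)"
      unfolding mat_app_def by measurable
    have "distr Q (borel_vec p) (mat_app p A) = distr M (borel_vec p) (\<lambda>\<omega>. mat_app p A (X 1 \<omega>))"
      unfolding Q_def by (subst distr_distr[OF _ X]) (auto simp: comp_def)
    also have "\<dots> = Q" using sym that by (simp add: rot_symmetric_def Q_def)
    finally show ?thesis .
  qed
  show ?thesis
    unfolding Q_def[symmetric]
    by unfold_locales (use sets_Q norm inv p n indep distr in auto)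
qed

lemma vdot_first_basis: "0 < p \<Longrightarrow> vdot p x (first_basis p) = x 0"
proof -
  assume "0 < p"
  have "vdot p x (first_basis p) = (\<Sum>k<p. if k = 0 then x k else 0)"
    unfolding vdot_def first_basis_def by (intro sum.cong) auto
  then show ?thesis using \<open>0 < p\<close> by simp
qed

text \<open>The estimate outside the locale and in terms of \<open>e_mom\<close> and
  \<open>e_cmom\<close>, to be instantiated with a different space, dimension and sample for each
  n.\<close>

lemma char_rayleigh_st_sample_hyp:
  fixes t \<mu> :: real
  assumes hyp: "sample_hyp n p F M X" and n: "1 \<le> n" and p: "2 \<le> p"
  defines "a \<equiv> e_mom M p X 1" and "w \<equiv> e_cmom M p X 2"
  shows "cmod (char (distr M borel (\<lambda>\<omega>. rayleigh_st n p X \<omega> - \<mu>)) t -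
      of_real (exp (- (t\<^sup>2 / 2 * (real p / real (p - 1)) * (1 - w - a\<^sup>2)\<^sup>2 * (real (n - 1) / real n)))))
    \<le> \<bar>t\<bar> * (\<bar>sqrt (real p / 2) * (real n * a\<^sup>2) - \<mu>\<bar> +
        sqrt (real p / 2) * (2 * \<bar>a\<bar> * sqrt (real n * w) + 2 * w + a\<^sup>2)) +
      (46 * t^4 / real n + 2 * t\<^sup>2 * sqrt (2 / real n + 8 / real (p - 1)))"
    and "rayleigh_st n p X \<in> borel_measurable M"
proof -
  interpret rot_sample M "distr M (borel_vec p) (X 1)" p n X
    by (rule rot_sample_of_sample_hyp[OF hyp n p])
  have X: "X 1 \<in> measurable M (borel_vec p)" using n by (intro measurable_X) simp
  have "0 \<in> {..<p}" using p by simp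
  note m [measurable] = measurable_component_singleton[OF this, of "\<lambda>_. borel :: real measure"]
  have a: "e1 = a"
    unfolding e1_def a_def e_mom_def vdot_first_basis[OF p_pos]
    by (subst integral_distr[OF X]) auto
  have w: "v = w"
    unfolding v_def a w_def e_cmom_def a_def vdot_first_basis[OF p_pos]
    by (subst integral_distr[OF X]) auto
  show "cmod (char (distr M borel (\<lambda>\<omega>. rayleigh_st n p X \<omega> - \<mu>)) t -
      of_real (exp (- (t\<^sup>2 / 2 * (real p / real (p - 1)) * (1 - w - a\<^sup>2)\<^sup>2 * (real (n - 1) / real n)))))
    \<le> \<bar>t\<bar> * (\<bar>sqrt (real p / 2) * (real n * a\<^sup>2) - \<mu>\<bar> +
        sqrt (real p / 2) * (2 * \<bar>a\<bar> * sqrt (real n * w) + 2 * w + a\<^sup>2)) +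
      (46 * t^4 / real n + 2 * t\<^sup>2 * sqrt (2 / real n + 8 / real (p - 1)))"
    using char_rayleigh_st_approx[of \<mu> t] unfolding f2_eq a w .
  show "rayleigh_st n p X \<in> borel_measurable M"
    using ess_bounded_rayleigh_st by (simp add: ess_bounded_def)
qed

text \<open>Absolute continuity excludes atoms. Weak convergence yields convergence of distribution
  functions only at continuity points of the limit, and here every point is one.\<close>

lemma isCont_cdf_std_normal: "isCont (cdf std_normal_distribution) x"
proof -
  interpret real_distribution std_normal_distribution by (rule real_dist_normal_dist)
  have "absolutely_continuous lborel std_normal_distribution"
    by (intro absolutely_continuousI_density) simp
  then have "{x} \<in> null_sets std_normal_distribution"
    using finite_imp_null_set_lborel[of "{x}"] unfolding absolutely_continuous_def by auto
  then show ?thesis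
    by (simp add: isCont_cdf measure_def null_sets_def)
qed

(* In (i) the ratios are taken in ennreal, where a / 0 = \<infinity> for a > 0. *)
theorem theorem5p2:
  fixes p :: "nat \<Rightarrow> nat"
    and F :: "nat \<Rightarrow> real \<Rightarrow> real"
    and M :: "nat \<Rightarrow> 'a measure"
    and X :: "nat \<Rightarrow> nat \<Rightarrow> 'a \<Rightarrow> nat \<Rightarrow> real"
    and \<tau> \<alpha> :: real
  assumes p_pos: "\<And>n. p n > 0"
    and p_lim: "filterlim p at_top sequentially"
    and hyp: "\<And>n. n \<ge> 1 \<Longrightarrow> sample_hyp n (p n) (F n) (M n) (X n)"
    and i: "(\<lambda>n. min
              (ennreal (real (p n) * (e_cmom (M n) (p n) (X n) 2)\<^sup>2)
                 / ennreal ((f_mom (M n) (p n) (X n) 2)\<^sup>2))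
              (ennreal (e_cmom (M n) (p n) (X n) 2)
                 / ennreal (real n * (e_mom (M n) (p n) (X n) 1)\<^sup>2)))
            \<longlonglongrightarrow> 0"
    and ii: "(\<lambda>n. e_cmom (M n) (p n) (X n) 4 / (e_cmom (M n) (p n) (X n) 2)\<^sup>2)
               \<in> o(\<lambda>n. real n)"
    and iii: "(\<lambda>n. f_mom (M n) (p n) (X n) 4 / (f_mom (M n) (p n) (X n) 2)\<^sup>2)
               \<in> o(\<lambda>n. real n)"
    and e1: "(\<lambda>n. e_mom (M n) (p n) (X n) 1
                   - \<tau> / (real n powr (1/2) * real (p n) powr (1/4)))
               \<in> o(\<lambda>n. 1 / (real n powr (1/2) * real (p n) powr (1/4)))"
    and e2: "(\<lambda>n. e_cmom (M n) (p n) (X n) 2 - 1 / real (p n))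
               \<in> o(\<lambda>n. 1 / real (p n))"
    and tau: "\<tau> \<ge> 0"
    and alpha: "0 < \<alpha>" "\<alpha> < 1"
  shows "(\<lambda>n. measure (M n)
              {\<omega> \<in> space (M n). rayleigh_st n (p n) (X n) \<omega> > z_quantile \<alpha>})
         \<longlonglongrightarrow> 1 - std_normal_cdf (z_quantile \<alpha> - \<tau>\<^sup>2 / sqrt 2)"
proof -
  define \<mu> where "\<mu> = \<tau>\<^sup>2 / sqrt 2"
  define z where "z = z_quantile \<alpha>"
  define a where "a n = e_mom (M n) (p n) (X n) 1" for n
  define w where "w n = e_cmom (M n) (p n) (X n) 2" for n
  \<comment> \<open>\<open>1 / s n\<close> is the rate prescribed for the mean; the rescaled
    \<open>A\<close> and \<open>W\<close> have the limits \<open>\<tau>\<close> and 1, and the error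
    terms are rewritten through them.\<close>
  define s where "s n = real n powr (1/2) * real (p n) powr (1/4)" for n
  define A where "A n = a n * s n" for n
  define W where "W n = w n * real (p n)" for n
  define R where "R n \<omega> = rayleigh_st n (p n) (X n) \<omega> - \<mu>" for n \<omega>
  define B where "B t n = t\<^sup>2 / 2 * (real (p n) / real (p n - 1)) * (1 - w n - (a n)\<^sup>2)\<^sup>2 *
    (real (n - 1) / real n)" for t n
  define err where "err t n = \<bar>t\<bar> * (\<bar>sqrt (real (p n) / 2) * (real n * (a n)\<^sup>2) - \<mu>\<bar> +
        sqrt (real (p n) / 2) * (2 * \<bar>a n\<bar> * sqrt (real n * w n) + 2 * w n + (a n)\<^sup>2)) +
      (46 * t^4 / real n + 2 * t\<^sup>2 * sqrt (2 / real n + 8 / real (p n - 1)))" for t n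

  have p_real: "filterlim (\<lambda>n. real (p n)) at_top sequentially"
    using filterlim_compose[OF filterlim_real_sequentially p_lim] .
  have p1_real: "filterlim (\<lambda>n. real (p n - 1)) at_top sequentially"
    using filterlim_compose[OF filterlim_real_sequentially
        filterlim_compose[OF filterlim_minus_const_nat_at_top p_lim]] .
  have n_real: "filterlim real at_top sequentially"
    by (rule filterlim_real_sequentially)
  have ev: "eventually (\<lambda>n. 1 \<le> n \<and> 2 \<le> p n) sequentially"
    using eventually_ge_at_top[of 1] p_lim[unfolded filterlim_at_top, rule_format, of 2]
    by eventually_elim simp
  then obtain N where N: "\<And>n. N \<le> n \<Longrightarrow> 1 \<le> n \<and> 2 \<le> p n"
    unfolding eventually_sequentially by blast

  have inv_n: "(\<lambda>n. 1 / real n) \<longlonglongrightarrow> 0"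
    by (rule lim_1_over_n)
  have inv_p: "(\<lambda>n. 1 / real (p n)) \<longlonglongrightarrow> 0"
    using tendsto_inverse_0_at_top[OF p_real] by (simp add: inverse_eq_divide)
  have inv_p1: "(\<lambda>n. 1 / real (p n - 1)) \<longlonglongrightarrow> 0"
    using tendsto_inverse_0_at_top[OF p1_real] by (simp add: inverse_eq_divide)
  have p4: "(\<lambda>n. real (p n) powr (- (1/4))) \<longlonglongrightarrow> 0"
    by (rule tendsto_neg_powr[OF _ p_real]) simp
  have inv_sp: "(\<lambda>n. 1 / sqrt (real (p n))) \<longlonglongrightarrow> 0"
    using tendsto_real_sqrt[OF inv_p] by (simp add: real_sqrt_divide)

  have A: "A \<longlonglongrightarrow> \<tau>"
  proof -
    have "eventually (\<lambda>n. (a n - \<tau> / s n) / (1 / s n) = A n - \<tau>) sequentially"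
      using ev
    proof eventually_elim
      case (elim n)
      then have "s n \<noteq> 0" by (simp add: s_def)
      then show ?case by (simp add: A_def field_simps)
    qed
    then have "(\<lambda>n. A n - \<tau>) \<longlonglongrightarrow> 0"
      using smalloD_tendsto[OF e1] by (auto simp: a_def s_def elim: Lim_transform_eventually)
    then show ?thesis by (simp add: LIM_zero_iff)
  qed
  have W: "W \<longlonglongrightarrow> 1"
  proof -
    have "(w n - 1 / real (p n)) / (1 / real (p n)) = W n - 1" for n
      using p_pos[of n] by (simp add: W_def field_simps)
    then have "(\<lambda>n. W n - 1) \<longlonglongrightarrow> 0"
      using smalloD_tendsto[OF e2] by (simp add: w_def)
    then show ?thesis by (simp add: LIM_zero_iff)
  qed
  have s2: "(s n)\<^sup>2 = real n * sqrt (real (p n))" for n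
  proof -
    have "(real (p n) powr (1/4))\<^sup>2 = sqrt (real (p n))"
      using p_pos[of n] by (simp add: powr_power powr_half_sqrt[symmetric])
    moreover have "(real n powr (1/2))\<^sup>2 = real n"
      by (simp add: powr_half_sqrt)
    ultimately show ?thesis by (simp add: s_def power_mult_distrib)
  qed
  have a2: "(a n)\<^sup>2 = (A n)\<^sup>2 * (1 / real n) * (1 / sqrt (real (p n)))" if "1 \<le> n" for n
  proof -
    have "(s n)\<^sup>2 \<noteq> 0" using that p_pos[of n] unfolding s2 by simp
    then have "(a n)\<^sup>2 = (A n)\<^sup>2 / (s n)\<^sup>2"
      by (simp add: A_def power_mult_distrib)
    then show ?thesis unfolding s2 by simp
  qed
  have w_eq: "w n = W n * (1 / real (p n))" for n
    using p_pos[of n] by (simp add: W_def)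

  have err: "err t \<longlonglongrightarrow> 0" for t
  proof -
    \<comment> \<open>The same error as a continuous expression in \<open>A\<close>,
      \<open>W\<close> and null sequences, from which its limit can be read off.\<close>
    define err' where "err' n = \<bar>t\<bar> * (\<bar>(A n)\<^sup>2 / sqrt 2 - \<mu>\<bar> +
        (sqrt 2 * \<bar>A n\<bar> * sqrt (W n) * real (p n) powr (- (1/4)) + sqrt 2 * W n * (1 / sqrt (real (p n))) +
          (A n)\<^sup>2 / sqrt 2 * (1 / real n))) +
      (46 * t^4 * (1 / real n) + 2 * t\<^sup>2 * sqrt (2 * (1 / real n) + 8 * (1 / real (p n - 1))))" for n
    have "err' \<longlonglongrightarrow> \<bar>t\<bar> * (\<bar>\<tau>\<^sup>2 / sqrt 2 - \<mu>\<bar> +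
        (sqrt 2 * \<bar>\<tau>\<bar> * sqrt 1 * 0 + sqrt 2 * 1 * 0 + \<tau>\<^sup>2 / sqrt 2 * 0)) +
      (46 * t^4 * 0 + 2 * t\<^sup>2 * sqrt (2 * 0 + 8 * 0))"
      unfolding err'_def[abs_def] by (intro tendsto_intros A W p4 inv_n inv_p inv_p1 inv_sp) auto
    then have lim: "err' \<longlonglongrightarrow> 0" by (simp add: \<mu>_def)
    have "eventually (\<lambda>n. err' n = err t n) sequentially"
      using ev
    proof eventually_elim
      case (elim n)
      \<comment> \<open>With \<open>r = q * q\<close> and \<open>p n = r * r\<close> the fractional
        powers become plain algebra.\<close>
      define r where "r = sqrt (real (p n))"
      define q where "q = real (p n) powr (1/4)"
      have n1: "1 \<le> real n" using elim by simp
      have r0: "0 < r" and q0: "0 < q" using p_pos[of n] by (auto simp: r_def q_def)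
      have r2: "real (p n) = r * r" by (simp add: r_def)
      have rq: "r = q * q"
        using p_pos[of n] by (simp add: r_def q_def powr_add[symmetric] powr_half_sqrt)
      have sn: "s n = sqrt (real n) * q" by (simp add: s_def q_def powr_half_sqrt)
      have h: "sqrt (real (p n) / 2) = r / sqrt 2" by (simp add: real_sqrt_divide r_def)
      have s22: "x / sqrt 2 * 2 = sqrt 2 * x" for x :: real
        by (simp add: field_simps)
      have 1: "r / sqrt 2 * (real n * (a n)\<^sup>2) = (A n)\<^sup>2 / sqrt 2"
        using n1 r0 a2[of n] elim by (simp add: r_def[symmetric])
      have 2: "r / sqrt 2 * (a n)\<^sup>2 = (A n)\<^sup>2 / sqrt 2 * (1 / real n)"
        using n1 r0 a2[of n] elim by (simp add: r_def[symmetric])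
      have 3: "r / sqrt 2 * (2 * w n) = sqrt 2 * W n * (1 / r)"
        using r0 unfolding w_eq r2 by (simp add: field_simps)
      have 4: "r / sqrt 2 * (2 * \<bar>a n\<bar> * sqrt (real n * w n)) = sqrt 2 * \<bar>A n\<bar> * sqrt (W n) * (1 / q)"
      proof -
        have "\<bar>A n\<bar> = \<bar>a n\<bar> * (sqrt (real n) * q)"
          using q0 by (simp add: A_def sn abs_mult)
        moreover have "sqrt (real n * w n) = sqrt (real n) * (sqrt (W n) / r)"
          by (simp add: w_eq real_sqrt_mult real_sqrt_divide r_def)
        ultimately show ?thesis
          using r0 q0 s22[of "\<bar>a n\<bar> * sqrt (real n) * sqrt (W n)"] by (simp add: mult_ac)
      qed
      have 5: "real (p n) powr (- (1/4)) = 1 / q"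
        by (simp add: q_def powr_minus_divide)
      show ?case
        unfolding err_def err'_def h distrib_left[of "r / sqrt 2"] 1 2 3 4 5 r_def[symmetric] by simp
    qed
    then show ?thesis using lim by (rule Lim_transform_eventually[rotated])
  qed

  have B: "B t \<longlonglongrightarrow> t\<^sup>2 / 2" for t
  proof -
    define B' where "B' n = t\<^sup>2 / 2 * (1 + 1 / real (p n - 1)) *
      (1 - W n * (1 / real (p n)) - (A n)\<^sup>2 * (1 / real n) * (1 / sqrt (real (p n))))\<^sup>2 * (1 - 1 / real n)" for n
    have "B' \<longlonglongrightarrow> t\<^sup>2 / 2 * (1 + 0) * (1 - 1 * 0 - \<tau>\<^sup>2 * 0 * 0)\<^sup>2 * (1 - 0)"
      unfolding B'_def[abs_def] by (intro tendsto_intros A W inv_n inv_p inv_p1 inv_sp)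
    moreover have "eventually (\<lambda>n. B' n = B t n) sequentially"
      using ev
    proof eventually_elim
      case (elim n)
      have "real (p n) / real (p n - 1) = 1 + 1 / real (p n - 1)"
        using elim by (simp add: field_simps of_nat_diff)
      moreover have "real (n - 1) / real n = 1 - 1 / real n"
        using elim by (simp add: field_simps of_nat_diff)
      ultimately show ?case
        using elim by (simp add: B_def B'_def a2 w_eq)
    qed
    ultimately show ?thesis
      by (auto elim: Lim_transform_eventually)
  qed

  have bound: "cmod (char (distr (M n) borel (R n)) t - of_real (exp (- B t n))) \<le> err t n"
    if "N \<le> n" for n t
    using char_rayleigh_st_sample_hyp(1)[OF hyp, of n \<mu> t] N[OF that]
    unfolding R_def[abs_def] B_def err_def a_def w_def by blast
  have meas: "rayleigh_st n (p n) (X n) \<in> borel_measurable (M n)" if "N \<le> n" for n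
    using char_rayleigh_st_sample_hyp(2)[OF hyp, of n] N[OF that] by blast
  have prob: "prob_space (M n)" if "N \<le> n" for n
    using hyp[of n] N[OF that] by (simp add: sample_hyp_def)
  \<comment> \<open>Levy's theorem is applied to a sequence of distributions defined at every index;
    the shift by \<open>N\<close> skips all indices with \<open>n = 0\<close> or
    \<open>p n = 1\<close>.\<close>
  define D where "D n = distr (M (n + N)) borel (R (n + N))" for n
  have D: "real_distribution (D n)" for n
    unfolding D_def R_def[abs_def] using meas[of "n + N"]
    by (intro prob_space.real_distribution_distr prob) auto
  have "(\<lambda>n. char (D n) t) \<longlonglongrightarrow> char std_normal_distribution t" for t
  proof -
    have "(\<lambda>n. char (D n) t - of_real (exp (- B t (n + N)))) \<longlonglongrightarrow> 0"
      by (rule Lim_null_comparison[OF _ LIMSEQ_ignore_initial_segment[OF err[of t], of N]])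
        (simp add: D_def bound)
    moreover have "(\<lambda>n. complex_of_real (exp (- B t (n + N)))) \<longlonglongrightarrow> of_real (exp (- (t\<^sup>2 / 2)))"
      by (intro tendsto_intros LIMSEQ_ignore_initial_segment B)
    ultimately have "(\<lambda>n. char (D n) t - of_real (exp (- B t (n + N))) + of_real (exp (- B t (n + N))))
        \<longlonglongrightarrow> 0 + of_real (exp (- (t\<^sup>2 / 2)))"
      by (rule tendsto_add)
    then show ?thesis by (simp add: char_std_normal_distribution)
  qed
  then have "weak_conv_m D std_normal_distribution"
    by (intro levy_continuity D real_dist_normal_dist)
  then have "(\<lambda>n. cdf (D n) (z - \<mu>)) \<longlonglongrightarrow> std_normal_cdf (z - \<mu>)"
    unfolding weak_conv_m_def weak_conv_def std_normal_cdf_def using isCont_cdf_std_normal by blast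
  then have "(\<lambda>n. 1 - cdf (D n) (z - \<mu>)) \<longlonglongrightarrow> 1 - std_normal_cdf (z - \<mu>)"
    by (intro tendsto_intros)
  moreover have "1 - cdf (D n) (z - \<mu>) = measure (M (n + N))
      {\<omega> \<in> space (M (n + N)). rayleigh_st (n + N) (p (n + N)) (X (n + N)) \<omega> > z}" for n
  proof -
    let ?n = "n + N"
    interpret prob_space "M ?n" by (rule prob) simp
    have R [measurable]: "rayleigh_st ?n (p ?n) (X ?n) \<in> borel_measurable (M ?n)"
      by (rule meas) simp
    \<comment> \<open>\<open>D n\<close> is the law of the statistic minus \<open>\<mu>\<close>, so
      its distribution function at \<open>z - \<mu>\<close> is the probability of not
      rejecting.\<close>
    have "cdf (D n) (z - \<mu>) = measure (M ?n) {\<omega> \<in> space (M ?n). rayleigh_st ?n (p ?n) (X ?n) \<omega> \<le> z}"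
      unfolding cdf_def D_def R_def[abs_def]
      by (subst measure_distr) (auto intro!: arg_cong[where f = "measure (M ?n)"])
    then show ?thesis
      using prob_neg[of "\<lambda>\<omega>. rayleigh_st ?n (p ?n) (X ?n) \<omega> \<le> z"] by (simp add: not_le)
  qed
  ultimately have "(\<lambda>n. measure (M (n + N))
      {\<omega> \<in> space (M (n + N)). rayleigh_st (n + N) (p (n + N)) (X (n + N)) \<omega> > z})
      \<longlonglongrightarrow> 1 - std_normal_cdf (z - \<mu>)"
    by simp
  from LIMSEQ_offset[OF this] show ?thesis
    by (simp add: z_def \<mu>_def)
qed

end
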